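(* Let $A,B$ be two finitely generated groups such that $A$ has subexponential growth. Let $G$ be a finitely presented group with exponential growth that belongs to $\mathfrak{M}_{exp}$. Then, for every coarse embedding $\rho:G\to A\wr B$, the image $\rho(G)$ lies in a bounded neighbourhood of some $B$-coset. Moreover, the size of this neighbourhood depends only on $A$, $B$, $G$, and the parameters of $\rho$.
   Context: $A\wr B=\left(\bigoplus_B A\right)\rtimes B$, where $B$ permutes the coordinates by left multiplication; finitely generated groups carry word metrics. A $B$-coset is a left coset of the subgroup $B$ of $A\wr B$. A coarse embedding $\rho:X\to Y$ is a map for which there are non-decreasing functions $\rho_-,\rho_+:[0,\infty)\to[0,\infty)$ with $\rho_-(t)\to\infty$ as $t\to\infty$ and $\rho_-(d(x,y))\leq d(\rho(x),\rho(y))\leq\rho_+(d(x,y))$ for all $x,y$; $(\rho_-,\rho_+)$ are its parameters. A finitely generated group has subexponential growth if the cardinality $\beta(r)$ of its balls of radius $r$ satisfies $\limsup_{r\to\infty}\frac1r\log\beta(r)=0$. For a metric space $X$, a subset $C\subset X$ and $R\geq 0$, $C^{+R}=\{x\in X : d(x,C)\leq R\}$. A $k$-path in $Y\subset X$ is a finite sequence of points of $Y$ whose consecutive points are at distance $\leq k$; $Y$ is $k$-coarsely connected if any two of its points are joined by a $k$-path in $Y$; the $k$-coarsely connected components of a subset are its maximal $k$-coarsely connected subsets. A collection $\mathcal{Z}$ of subsets of $X$ coarsely separates $X$ if there exist $k,L\geq 0$ such that $X$ is $k$-coarsely connected and, for every $D\geq 0$, there is some $Z\in\mathcal{Z}$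 such that $X\setminus Z^{+L}$ has at least two $k$-coarsely connected components containing points at distance $\geq D$ from $Z$. A connected graph is identified with its vertex set with the path metric. For a connected bounded degree graph $X$ and a family $\mathcal{S}$ of sets of vertices, $V_{\mathcal{S}}(r)=\sup\{|B_X(s,r)\cap S| : s\in S,\ S\in\mathcal{S}\}$. $f\gtrsim g$ means that there is $C>0$ with $f(t)\geq Cg(Ct+C)+C$ for all $t\geq0$. A metric space (in particular a finitely generated group with a word metric) belongs to $\mathfrak{M}_{exp}$ if it is quasi-isometric to a connected bounded degree graph in which every coarsely separating family $\mathcal{S}$ satisfies $V_{\mathcal{S}}(r)\gtrsim e^r$. *)

theory Defs
  imports "HOL-Analysis.Analysis" "HOL-Algebra.Product_Groups"
begin

section \<open>Wreath products\<close>

definition semidirect_product ::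
  "('n, 'c) monoid_scheme \<Rightarrow> ('h, 'd) monoid_scheme \<Rightarrow> ('h \<Rightarrow> 'n \<Rightarrow> 'n) \<Rightarrow> ('n \<times> 'h) monoid" where
  "semidirect_product N H \<phi> =
     \<lparr> carrier = carrier N \<times> carrier H,
       mult = (\<lambda>(n, h) (n', h'). (n \<otimes>\<^bsub>N\<^esub> \<phi> h n', h \<otimes>\<^bsub>H\<^esub> h')),
       one = (\<one>\<^bsub>N\<^esub>, \<one>\<^bsub>H\<^esub>) \<rparr>"

text \<open>The element \<open>b\<close> carries the coordinate at \<open>x\<close> to the coordinate at \<open>b x\<close>.\<close>

definition shift :: "('b, 'd) monoid_scheme \<Rightarrow> 'b \<Rightarrow> ('b \<Rightarrow> 'a) \<Rightarrow> 'b \<Rightarrow> 'a" where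
  "shift B b f = (\<lambda>x\<in>carrier B. f (inv\<^bsub>B\<^esub> b \<otimes>\<^bsub>B\<^esub> x))"

definition wreath_product ::
  "('a, 'c) monoid_scheme \<Rightarrow> ('b, 'd) monoid_scheme \<Rightarrow> (('b \<Rightarrow> 'a) \<times> 'b) monoid" where
  "wreath_product A B = semidirect_product (sum_group (carrier B) (\<lambda>_. A)) B (shift B)"

definition acting_subgroup ::
  "('a, 'c) monoid_scheme \<Rightarrow> ('b, 'd) monoid_scheme \<Rightarrow> (('b \<Rightarrow> 'a) \<times> 'b) set" where
  "acting_subgroup A B = {\<one>\<^bsub>sum_group (carrier B) (\<lambda>_. A)\<^esub>} \<times> carrier B"

definition acting_cosets ::
  "('a, 'c) monoid_scheme \<Rightarrow> ('b, 'd) monoid_scheme \<Rightarrow> (('b \<Rightarrow> 'a) \<times> 'b) set set" where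
  "acting_cosets A B =
     {g <#\<^bsub>wreath_product A B\<^esub> acting_subgroup A B | g. g \<in> carrier (wreath_product A B)}"

section \<open>Finitely presented groups\<close>

text \<open>A word over \<open>X\<close> is a list of pairs \<open>(x, e)\<close>, where \<open>(x, True)\<close> stands for the letter \<open>x\<close> and
  \<open>(x, False)\<close> for its inverse.\<close>

definition cancel_step :: "'x set \<Rightarrow> ('x \<times> bool) list \<Rightarrow> ('x \<times> bool) list \<Rightarrow> bool" where
  "cancel_step X u v \<longleftrightarrow> u \<in> lists (X \<times> UNIV) \<and>
     (\<exists>p q x e. u = p @ [(x, e), (x, \<not> e)] @ q \<and> v = p @ q)"

definition word_rel :: "'x set \<Rightarrow> (('x \<times> bool) list \<times> ('x \<times> bool) list) set" where
  "word_rel X = {(u, v). u \<in> lists (X \<times> UNIV) \<and> v \<in> lists (X \<times> UNIV) \<and> equivclp (cancel_step X) u v}"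

definition free_group :: "'x set \<Rightarrow> ('x \<times> bool) list set monoid" where
  "free_group X =
     \<lparr> carrier = lists (X \<times> UNIV) // word_rel X,
       mult = (\<lambda>P Q. \<Union>u\<in>P. \<Union>v\<in>Q. word_rel X `` {u @ v}),
       one = word_rel X `` {[]} \<rparr>"

definition normal_closure :: "('a, 'c) monoid_scheme \<Rightarrow> 'a set \<Rightarrow> 'a set" where
  "normal_closure G R = \<Inter>{N. N \<lhd> G \<and> R \<subseteq> N}"

definition finitely_presented :: "('a, 'c) monoid_scheme \<Rightarrow> bool" where
  "finitely_presented G \<longleftrightarrow>
     (\<exists>(n::nat) R. finite R \<and> R \<subseteq> carrier (free_group {..<n}) \<and>
        G \<cong> free_group {..<n} Mod normal_closure (free_group {..<n}) R)"

section \<open>Word metrics and growth\<close>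

definition finite_generating_set :: "('a, 'c) monoid_scheme \<Rightarrow> 'a set \<Rightarrow> bool" where
  "finite_generating_set G S \<longleftrightarrow> finite S \<and> S \<subseteq> carrier G \<and> generate G S = carrier G"

definition finitely_generated :: "('a, 'c) monoid_scheme \<Rightarrow> bool" where
  "finitely_generated G \<longleftrightarrow> (\<exists>S. finite_generating_set G S)"

definition word_length :: "('a, 'c) monoid_scheme \<Rightarrow> 'a set \<Rightarrow> 'a \<Rightarrow> nat" where
  "word_length G S g =
     (LEAST n. \<exists>w. length w = n \<and> set w \<subseteq> S \<union> m_inv G ` S \<and> foldr (mult G) w \<one>\<^bsub>G\<^esub> = g)"

definition word_dist :: "('a, 'c) monoid_scheme \<Rightarrow> 'a set \<Rightarrow> 'a \<Rightarrow> 'a \<Rightarrow> real" where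
  "word_dist G S g h = real (word_length G S (inv\<^bsub>G\<^esub> g \<otimes>\<^bsub>G\<^esub> h))"

text \<open>Balls are closed.\<close>

definition ball_on :: "'x set \<Rightarrow> ('x \<Rightarrow> 'x \<Rightarrow> real) \<Rightarrow> 'x \<Rightarrow> real \<Rightarrow> 'x set" where
  "ball_on M d x r = {y \<in> M. d x y \<le> r}"

definition growth_rate :: "('a, 'c) monoid_scheme \<Rightarrow> 'a set \<Rightarrow> ereal" where
  "growth_rate G S =
     Limsup at_top (\<lambda>r::real. ereal (ln (real (card (ball_on (carrier G) (word_dist G S) \<one>\<^bsub>G\<^esub> r))) / r))"

text \<open>Whether the growth rate vanishes does not depend on the finite generating set.\<close>

definition subexponential_growth :: "('a, 'c) monoid_scheme \<Rightarrow> bool" where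
  "subexponential_growth G \<longleftrightarrow> (\<exists>S. finite_generating_set G S \<and> growth_rate G S = 0)"

definition exponential_growth :: "('a, 'c) monoid_scheme \<Rightarrow> bool" where
  "exponential_growth G \<longleftrightarrow> (\<exists>S. finite_generating_set G S \<and> growth_rate G S > 0)"

section \<open>Coarse geometry\<close>

text \<open>A metric space is a carrier set \<open>M\<close> with a distance function \<open>d\<close>.  The distance to a set takes
  values in \<open>ennreal\<close> so that the distance to the empty set is infinite (for \<open>infdist\<close> it is 0).\<close>

definition dist_to :: "('x \<Rightarrow> 'x \<Rightarrow> real) \<Rightarrow> 'x \<Rightarrow> 'x set \<Rightarrow> ennreal" where
  "dist_to d x C = (INF c\<in>C. ennreal (d x c))"

definition nbhd :: "'x set \<Rightarrow> ('x \<Rightarrow> 'x \<Rightarrow> real) \<Rightarrow> 'x set \<Rightarrow> real \<Rightarrow> 'x set" where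
  "nbhd M d C R = {x \<in> M. dist_to d x C \<le> ennreal R}"

definition coarse_params :: "(real \<Rightarrow> real) \<Rightarrow> (real \<Rightarrow> real) \<Rightarrow> bool" where
  "coarse_params \<rho>m \<rho>p \<longleftrightarrow>
     \<rho>m \<in> {0..} \<rightarrow> {0..} \<and> \<rho>p \<in> {0..} \<rightarrow> {0..} \<and>
     mono_on {0..} \<rho>m \<and> mono_on {0..} \<rho>p \<and> filterlim \<rho>m at_top at_top"

definition coarse_embedding ::
  "'x set \<Rightarrow> ('x \<Rightarrow> 'x \<Rightarrow> real) \<Rightarrow> 'y set \<Rightarrow> ('y \<Rightarrow> 'y \<Rightarrow> real) \<Rightarrow>
   (real \<Rightarrow> real) \<Rightarrow> (real \<Rightarrow> real) \<Rightarrow> ('x \<Rightarrow> 'y) \<Rightarrow> bool" where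
  "coarse_embedding M d N e \<rho>m \<rho>p \<rho> \<longleftrightarrow>
     coarse_params \<rho>m \<rho>p \<and> \<rho> \<in> M \<rightarrow> N \<and>
     (\<forall>x\<in>M. \<forall>y\<in>M. \<rho>m (d x y) \<le> e (\<rho> x) (\<rho> y) \<and> e (\<rho> x) (\<rho> y) \<le> \<rho>p (d x y))"

definition quasi_isometric ::
  "'x set \<Rightarrow> ('x \<Rightarrow> 'x \<Rightarrow> real) \<Rightarrow> 'y set \<Rightarrow> ('y \<Rightarrow> 'y \<Rightarrow> real) \<Rightarrow> bool" where
  "quasi_isometric M d N e \<longleftrightarrow>
     (\<exists>f \<in> M \<rightarrow> N. \<exists>a\<ge>1. \<exists>b\<ge>0.
        (\<forall>x\<in>M. \<forall>y\<in>M. d x y / a - b \<le> e (f x) (f y) \<and> e (f x) (f y) \<le> a * d x y + b) \<and>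
        (\<forall>z\<in>N. \<exists>x\<in>M. e (f x) z \<le> b))"

definition coarsely_connected :: "('x \<Rightarrow> 'x \<Rightarrow> real) \<Rightarrow> real \<Rightarrow> 'x set \<Rightarrow> bool" where
  "coarsely_connected d k Y \<longleftrightarrow>
     (\<forall>x\<in>Y. \<forall>y\<in>Y. \<exists>p. p \<noteq> [] \<and> hd p = x \<and> last p = y \<and> set p \<subseteq> Y \<and>
        successively (\<lambda>u v. d u v \<le> k) p)"

definition coarse_components :: "('x \<Rightarrow> 'x \<Rightarrow> real) \<Rightarrow> real \<Rightarrow> 'x set \<Rightarrow> 'x set set" where
  "coarse_components d k Y =
     {C. C \<subseteq> Y \<and> coarsely_connected d k C \<and>
         (\<forall>C'. C \<subseteq> C' \<and> C' \<subseteq> Y \<and> coarsely_connected d k C' \<longrightarrow> C' = C)}"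

definition coarsely_separates :: "'x set \<Rightarrow> ('x \<Rightarrow> 'x \<Rightarrow> real) \<Rightarrow> 'x set set \<Rightarrow> bool" where
  "coarsely_separates M d \<Z> \<longleftrightarrow> \<Z> \<subseteq> Pow M \<and>
     (\<exists>k\<ge>0. \<exists>L\<ge>0. coarsely_connected d k M \<and>
        (\<forall>D\<ge>0. \<exists>Z\<in>\<Z>. \<exists>C1 \<in> coarse_components d k (M - nbhd M d Z L).
                      \<exists>C2 \<in> coarse_components d k (M - nbhd M d Z L).
           C1 \<noteq> C2 \<and>
           (\<exists>x\<in>C1. dist_to d x Z \<ge> ennreal D) \<and> (\<exists>x\<in>C2. dist_to d x Z \<ge> ennreal D)))"

definition gtrsim :: "(real \<Rightarrow> ennreal) \<Rightarrow> (real \<Rightarrow> ennreal) \<Rightarrow> bool" where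
  "gtrsim f g \<longleftrightarrow> (\<exists>C>0. \<forall>t\<ge>0. f t \<ge> ennreal C * g (C * t + C) + ennreal C)"

section \<open>Graphs\<close>

text \<open>A graph is a vertex set \<open>V\<close> with a symmetric irreflexive adjacency relation \<open>E\<close>.\<close>

definition connected_bounded_degree_graph :: "'v set \<Rightarrow> ('v \<times> 'v) set \<Rightarrow> bool" where
  "connected_bounded_degree_graph V E \<longleftrightarrow>
     E \<subseteq> V \<times> V \<and> sym E \<and> irrefl E \<and>
     (\<forall>u\<in>V. \<forall>v\<in>V. (u, v) \<in> E\<^sup>*) \<and>
     (\<exists>N::nat. \<forall>v\<in>V. finite (E `` {v}) \<and> card (E `` {v}) \<le> N)"

definition graph_dist :: "('v \<times> 'v) set \<Rightarrow> 'v \<Rightarrow> 'v \<Rightarrow> real" where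
  "graph_dist E u v = real (LEAST n. (u, v) \<in> E ^^ n)"

definition family_volume :: "'v set \<Rightarrow> ('v \<times> 'v) set \<Rightarrow> 'v set set \<Rightarrow> real \<Rightarrow> ennreal" where
  "family_volume V E \<S> r =
     (SUP S\<in>\<S>. SUP s\<in>S. of_nat (card (ball_on V (graph_dist E) s r \<inter> S)))"

text \<open>A connected graph of bounded degree has countably many vertices, so it is no restriction to
  take the vertices to be natural numbers.\<close>

definition in_M_exp :: "'x set \<Rightarrow> ('x \<Rightarrow> 'x \<Rightarrow> real) \<Rightarrow> bool" where
  "in_M_exp M d \<longleftrightarrow>
     (\<exists>(V::nat set) E. connected_bounded_degree_graph V E \<and>
        quasi_isometric M d V (graph_dist E) \<and>
        (\<forall>\<S>. coarsely_separates V (graph_dist E) \<S> \<longrightarrow>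
              gtrsim (family_volume V E \<S>) (\<lambda>r. ennreal (exp r))))"

text \<open>Membership does not depend on the word metric, since any two are bi-Lipschitz equivalent.\<close>

definition group_in_M_exp :: "('a, 'c) monoid_scheme \<Rightarrow> bool" where
  "group_in_M_exp G \<longleftrightarrow> (\<exists>S. finite_generating_set G S \<and> in_M_exp (carrier G) (word_dist G S))"

end

theory Submission
  imports Defs
begin

text \<open>
  For a map \<open>\<rho>\<close> into the wreath product call \<open>fst (\<rho> x)\<close> the lamp configuration at \<open>x\<close> and \<open>snd (\<rho> x)\<close> the
  arrow at \<open>x\<close>.  Moving in the wreath product by one letter only affects lamps near the arrow.  If \<open>\<rho>\<close>
  is a coarse embedding, the lamp at a site \<open>p\<close> can therefore change only on the set \<open>Y\<close> of those
  points of \<open>G\<close> at which the arrow is close to \<open>p\<close>.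

  The set \<open>Y\<close> may be very large, because the lamps away from \<open>p\<close> are arbitrary on it.  Its coarse
  components are small: along a chain of bounded hops in \<open>Y\<close> the arrow stays near \<open>p\<close>, so only
  boundedly many lamps can change.  A component thus embeds, up to bounded fibres, into a finite
  power of \<open>A\<close> times a finite set, and has subexponential growth, uniformly in \<open>p\<close> and \<open>\<rho>\<close>
  (\<open>component_volume\<close>).  Since \<open>G\<close> is in the class \<open>M_exp\<close>, these components do not coarsely separate \<open>G\<close>:
  points far from a component are joined by a path that avoids it (\<open>far_points_connected\<close>).

  Finite presentation passes from the components to \<open>Y\<close>: a function on \<open>G\<close> that changes only on \<open>Y\<close>
  takes the same value at two points unless a single component separates them
  (\<open>constant_unless_component_separates\<close>).  Indeed, its coboundary is the sum of its parts on the
  components; each part integrates to 0 over the relators, because a short loop meets at most one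
  component, and is therefore exact (\<open>finitely_presented_short_loops\<close>).  Applied to the lamp at \<open>p\<close>,
  this gives a limit state \<open>c p\<close> which the lamp at \<open>p\<close> has at all points whose arrow is far from \<open>p\<close>
  (\<open>lamp_constant_far_away\<close>).

  Finally, exponential growth prevents the arrow from staying near \<open>p\<close> on a large ball (\<open>escape\<close>).  So
  the limit state exists, and the lamp at \<open>p\<close> is always at bounded distance from it.  Hence \<open>\<rho> x\<close> is
  at bounded distance from the element with configuration \<open>c\<close> and the arrow of \<open>\<rho> x\<close>, and these
  elements lie in one coset (\<open>tame_map_near_coset\<close>).  All constants depend only on the groups, their
  generating sets and the parameters.
\<close>

section \<open>Word metrics\<close>

locale marked_group = group G for G (structure) +
  fixes S :: "'a set"
  assumes generating: "finite_generating_set G S"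
begin

abbreviation letters :: "'a set" where "letters \<equiv> S \<union> m_inv G ` S"

abbreviation word_prod :: "'a list \<Rightarrow> 'a" where "word_prod w \<equiv> foldr (\<otimes>) w \<one>"

abbreviation wd :: "'a \<Rightarrow> 'a \<Rightarrow> real" where "wd \<equiv> word_dist G S"

lemma letters_closed: "letters \<subseteq> carrier G"
  using generating by (auto simp: finite_generating_set_def)

lemma finite_letters: "finite letters"
  using generating by (auto simp: finite_generating_set_def)

lemma letters_inv: "s \<in> letters \<Longrightarrow> inv s \<in> letters"
  using generating by (auto simp: finite_generating_set_def)

lemma word_prod_closed [simp]: "set w \<subseteq> carrier G \<Longrightarrow> word_prod w \<in> carrier G"
  by (induction w) auto

lemma word_prod_append:
  "set u \<subseteq> carrier G \<Longrightarrow> set v \<subseteq> carrier G \<Longrightarrow> word_prod (u @ v) = word_prod u \<otimes> word_prod v"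
  by (induction u) (auto simp: m_assoc)

lemma letters_carrier: "set w \<subseteq> letters \<Longrightarrow> set w \<subseteq> carrier G"
  using letters_closed by blast

lemma word_prod_inverse:
  "set w \<subseteq> letters \<Longrightarrow>
    set (rev (map (m_inv G) w)) \<subseteq> letters \<and> word_prod (rev (map (m_inv G) w)) = inv (word_prod w)"
proof (induction w)
  case (Cons s w)
  have s: "s \<in> carrier G" "inv s \<in> letters" and w: "set w \<subseteq> carrier G"
    using Cons.prems letters_closed letters_inv[of s] letters_carrier[of w] by auto
  have w': "set (rev (map (m_inv G) w)) \<subseteq> letters"
    "word_prod (rev (map (m_inv G) w)) = inv (word_prod w)"
    using Cons by auto
  have "set (rev (map (m_inv G) w)) \<subseteq> carrier G"
    using w'(1) by (rule letters_carrier)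
  then have "word_prod (rev (map (m_inv G) w) @ [inv s]) = inv (word_prod w) \<otimes> inv s"
    using s w' by (subst word_prod_append) auto
  then show ?case
    using s w w' by (simp add: inv_mult_group del: foldr_append)
qed simp

lemma ex_word:
  assumes "g \<in> carrier G" shows "\<exists>w. set w \<subseteq> letters \<and> word_prod w = g"
proof -
  have "g \<in> generate G S"
    using assms generating by (simp add: finite_generating_set_def)
  then show ?thesis
  proof induction
    case one then show ?case by (intro exI[of _ "[]"]) simp
  next
    case (incl h) then show ?case
      using letters_closed by (intro exI[of _ "[h]"]) auto
  next
    case (inv h) then show ?case
      using letters_closed by (intro exI[of _ "[inv h]"]) auto
  next
    case (eng h1 h2)
    then obtain u v where "set u \<subseteq> letters" "word_prod u = h1" "set v \<subseteq> letters" "word_prod v = h2"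
      by blast
    then show ?case
      using word_prod_append[OF letters_carrier letters_carrier, of u v]
      by (intro exI[of _ "u @ v"]) auto
  qed
qed

lemma word_length_le: "set w \<subseteq> letters \<Longrightarrow> word_length G S (word_prod w) \<le> length w"
  unfolding word_length_def by (rule Least_le) auto

lemma geodesic_word:
  assumes "g \<in> carrier G"
  shows "\<exists>w. set w \<subseteq> letters \<and> word_prod w = g \<and> length w = word_length G S g"
proof -
  have "\<exists>n w. length w = n \<and> set w \<subseteq> letters \<and> word_prod w = g"
    using ex_word[OF assms] by blast
  from LeastI_ex[OF this] show ?thesis unfolding word_length_def by blast
qed

lemma geodesic:
  assumes "x \<in> carrier G" "y \<in> carrier G"
  shows "\<exists>w. set w \<subseteq> letters \<and> x \<otimes> word_prod w = y \<and> real (length w) = wd x y"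
proof -
  obtain w where "set w \<subseteq> letters" "word_prod w = inv x \<otimes> y"
    "length w = word_length G S (inv x \<otimes> y)"
    using geodesic_word[of "inv x \<otimes> y"] assms by auto
  then show ?thesis
    using assms by (intro exI[of _ w]) (auto simp: word_dist_def m_assoc[symmetric])
qed

lemma wd_le_length:
  assumes "x \<in> carrier G" "set w \<subseteq> letters"
  shows "wd x (x \<otimes> word_prod w) \<le> length w"
proof -
  have "inv x \<otimes> (x \<otimes> word_prod w) = word_prod w"
    using assms letters_carrier by (simp add: m_assoc[symmetric])
  then show ?thesis
    using word_length_le[OF assms(2)] by (simp add: word_dist_def)
qed

lemma wd_letter: "x \<in> carrier G \<Longrightarrow> s \<in> letters \<Longrightarrow> wd x (x \<otimes> s) \<le> 1"
  using wd_le_length[of x "[s]"] letters_closed by auto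

lemma wd_nonneg [simp]: "0 \<le> wd x y"
  by (simp add: word_dist_def)

lemma wd_refl [simp]: "x \<in> carrier G \<Longrightarrow> wd x x = 0"
  using wd_le_length[of x "[]"] wd_nonneg[of x x] by simp

lemma wd_sym_le:
  assumes "x \<in> carrier G" "y \<in> carrier G" shows "wd y x \<le> wd x y"
proof -
  obtain w where w: "set w \<subseteq> letters" "x \<otimes> word_prod w = y" "real (length w) = wd x y"
    using geodesic[OF assms] by blast
  have "set (rev (map (m_inv G) w)) \<subseteq> letters"
    "word_prod (rev (map (m_inv G) w)) = inv (word_prod w)"
    using word_prod_inverse[OF w(1)] by auto
  moreover have "y \<otimes> inv (word_prod w) = x"
    using w assms letters_carrier[OF w(1)] by (metis inv_solve_right word_prod_closed)
  ultimately show ?thesis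
    using wd_le_length[of y "rev (map (m_inv G) w)"] assms w(3) by simp
qed

lemma wd_sym: "x \<in> carrier G \<Longrightarrow> y \<in> carrier G \<Longrightarrow> wd x y = wd y x"
  by (intro antisym wd_sym_le)

text \<open>Points at distance \<open>n\<close> are joined by \<open>n\<close> edges of the Cayley graph, so the triangle inequality for
  \<open>e\<close> reduces a Lipschitz bound to single edges.  All Lipschitz estimates below are instances.\<close>

lemma lipschitz_from_edges:
  fixes e :: "'a \<Rightarrow> 'a \<Rightarrow> real"
  assumes edge: "\<And>x s. x \<in> carrier G \<Longrightarrow> s \<in> letters \<Longrightarrow> e x (x \<otimes> s) \<le> c"
    and tri: "\<And>x y z. x \<in> carrier G \<Longrightarrow> y \<in> carrier G \<Longrightarrow> z \<in> carrier G \<Longrightarrow> e x z \<le> e x y + e y z"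
    and refl: "\<And>x. x \<in> carrier G \<Longrightarrow> e x x \<le> 0"
    and "x \<in> carrier G" "y \<in> carrier G"
  shows "e x y \<le> c * wd x y"
proof -
  have *: "e x (x \<otimes> word_prod w) \<le> c * length w" if "x \<in> carrier G" "set w \<subseteq> letters" for x w
    using that
  proof (induction w arbitrary: x)
    case Nil then show ?case using refl by simp
  next
    case (Cons s w)
    have c: "s \<in> carrier G" "word_prod w \<in> carrier G"
      using Cons.prems letters_closed letters_carrier[of w] by auto
    have "e x (x \<otimes> (s \<otimes> word_prod w)) \<le> e x (x \<otimes> s) + e (x \<otimes> s) (x \<otimes> (s \<otimes> word_prod w))"
      using Cons.prems c by (intro tri) auto
    also have "e x (x \<otimes> s) \<le> c" using Cons.prems by (intro edge) auto
    also have "e (x \<otimes> s) (x \<otimes> (s \<otimes> word_prod w)) \<le> c * length w"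
      using Cons.IH[of "x \<otimes> s"] Cons.prems c by (simp add: m_assoc)
    finally show ?case by (simp add: algebra_simps)
  qed
  obtain w where "set w \<subseteq> letters" "x \<otimes> word_prod w = y" "real (length w) = wd x y"
    using geodesic assms(4,5) by blast
  with *[of x w] assms(4) show ?thesis by auto
qed

lemma wd_triangle:
  assumes "x \<in> carrier G" "y \<in> carrier G" "z \<in> carrier G"
  shows "wd x z \<le> wd x y + wd y z"
proof -
  obtain u where u: "set u \<subseteq> letters" "x \<otimes> word_prod u = y" "real (length u) = wd x y"
    using geodesic assms by blast
  obtain v where v: "set v \<subseteq> letters" "y \<otimes> word_prod v = z" "real (length v) = wd y z"
    using geodesic assms by blast
  have "x \<otimes> word_prod (u @ v) = z"
    using u v assms letters_carrier[OF u(1)] letters_carrier[OF v(1)]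
    by (metis m_assoc word_prod_append word_prod_closed)
  then show ?thesis using wd_le_length[of x "u @ v"] u v assms by (simp del: foldr_append)
qed

lemma wd_left_invariant:
  assumes "g \<in> carrier G" "x \<in> carrier G" "y \<in> carrier G"
  shows "wd (g \<otimes> x) (g \<otimes> y) = wd x y"
proof -
  have "inv (g \<otimes> x) \<otimes> (g \<otimes> y) = inv x \<otimes> ((inv g \<otimes> g) \<otimes> y)"
    using assms unfolding inv_mult_group[OF assms(1,2)] by (metis inv_closed m_assoc m_closed)
  then show ?thesis using assms by (simp add: word_dist_def)
qed

lemma finite_ball:
  assumes "x \<in> carrier G" shows "finite (ball_on (carrier G) wd x r)"
proof (rule finite_subset)
  show "ball_on (carrier G) wd x r \<subseteq>
      (\<lambda>w. x \<otimes> word_prod w) ` {w. set w \<subseteq> letters \<and> length w \<le> nat \<lfloor>r\<rfloor>}"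
  proof
    fix y assume y: "y \<in> ball_on (carrier G) wd x r"
    then obtain w where w: "set w \<subseteq> letters" "x \<otimes> word_prod w = y" "real (length w) = wd x y"
      using geodesic[OF assms, of y] by (auto simp: ball_on_def)
    with y have "real (length w) \<le> r" by (auto simp: ball_on_def)
    then have "length w \<le> nat \<lfloor>r\<rfloor>" by linarith
    with w show "y \<in> (\<lambda>w. x \<otimes> word_prod w) ` {w. set w \<subseteq> letters \<and> length w \<le> nat \<lfloor>r\<rfloor>}"
      by blast
  qed
  show "finite ((\<lambda>w. x \<otimes> word_prod w) ` {w. set w \<subseteq> letters \<and> length w \<le> nat \<lfloor>r\<rfloor>})"
    using finite_lists_length_le[OF finite_letters] by simp
qed

abbreviation growth :: "real \<Rightarrow> nat" where
  "growth r \<equiv> card (ball_on (carrier G) wd \<one> r)"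

lemma ball_translate:
  assumes "x \<in> carrier G"
  shows "ball_on (carrier G) wd x r = (\<otimes>) x ` ball_on (carrier G) wd \<one> r"
proof (intro equalityI subsetI)
  fix y assume y: "y \<in> ball_on (carrier G) wd x r"
  then have "wd \<one> (inv x \<otimes> y) = wd x y"
    using assms wd_left_invariant[of x \<one> "inv x \<otimes> y"]
    by (auto simp: ball_on_def m_assoc[symmetric])
  with y assms show "y \<in> (\<otimes>) x ` ball_on (carrier G) wd \<one> r"
    by (intro image_eqI[of _ _ "inv x \<otimes> y"]) (auto simp: ball_on_def m_assoc[symmetric])
next
  fix y assume "y \<in> (\<otimes>) x ` ball_on (carrier G) wd \<one> r"
  then show "y \<in> ball_on (carrier G) wd x r"
    using assms wd_left_invariant[of x \<one>] by (auto simp: ball_on_def)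
qed

lemma card_ball:
  assumes "x \<in> carrier G" shows "card (ball_on (carrier G) wd x r) = growth r"
  unfolding ball_translate[OF assms]
  by (rule card_image) (use assms in \<open>auto simp: inj_on_def ball_on_def\<close>)

lemma growth_pos: "0 \<le> r \<Longrightarrow> 0 < growth r"
  using finite_ball[of \<one> r] by (auto simp: card_gt_0_iff ball_on_def)

end

text \<open>The letters of one generating set have bounded length with respect to the other.\<close>

lemma word_dist_bilipschitz:
  assumes "marked_group G S" "marked_group G S'"
  shows "\<exists>c>0. \<forall>x\<in>carrier G. \<forall>y\<in>carrier G. word_dist G S x y \<le> c * word_dist G S' x y"
proof -
  interpret M: marked_group G S by fact
  interpret M': marked_group G S' by fact
  define c where "c = Max (insert 1 (M.wd \<one>\<^bsub>G\<^esub> ` M'.letters))"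
  have fin: "finite (insert 1 (M.wd \<one>\<^bsub>G\<^esub> ` M'.letters))" using M'.finite_letters by simp
  have "c > 0" unfolding c_def using fin by (auto simp: Max_gr_iff)
  moreover have "M.wd x y \<le> c * M'.wd x y" if "x \<in> carrier G" "y \<in> carrier G" for x y
  proof (rule M'.lipschitz_from_edges)
    fix x s assume x: "x \<in> carrier G" and s: "s \<in> M'.letters"
    then have "M.wd x (x \<otimes>\<^bsub>G\<^esub> s) = M.wd \<one>\<^bsub>G\<^esub> s"
      using M.wd_left_invariant[of x "\<one>\<^bsub>G\<^esub>" s] M'.letters_closed by auto
    also have "\<dots> \<le> c" unfolding c_def using fin s by (intro Max_ge) auto
    finally show "M.wd x (x \<otimes>\<^bsub>G\<^esub> s) \<le> c" .
  qed (use that M.wd_triangle in auto)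
  ultimately show ?thesis by blast
qed

section \<open>Loops in Cayley graphs of finitely presented groups\<close>

lemma word_rel_equiv: "equiv (lists (X \<times> UNIV)) (word_rel X)"
  by (rule equivI) (auto simp: word_rel_def refl_on_def sym_def trans_def
      intro: equivclp_sym equivclp_trans)

lemma word_rel_carrier: "(u, v) \<in> word_rel X \<Longrightarrow> u \<in> lists (X \<times> UNIV) \<and> v \<in> lists (X \<times> UNIV)"
  by (auto simp: word_rel_def)

lemma cancel_step_imp_word_rel: "cancel_step X u v \<Longrightarrow> (u, v) \<in> word_rel X"
  using r_into_equivclp[of "cancel_step X" u v] by (auto simp: word_rel_def) (auto simp: cancel_step_def)

text \<open>A function of words that ignores cancellations descends to the free group.  This is applied to the
  integral of a cochain along the path read by a word.\<close>

lemma word_rel_invariant: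
  assumes "(u, v) \<in> word_rel X"
    and inv: "\<And>p q x e. p @ q \<in> lists (X \<times> UNIV) \<Longrightarrow> x \<in> X \<Longrightarrow> I (p @ [(x, e), (x, \<not> e)] @ q) = I (p @ q)"
  shows "I u = I v"
proof -
  have step: "I y = I z" if "cancel_step X y z" for y z
    using that unfolding cancel_step_def by (auto intro!: inv[symmetric] inv[simplified])
  have "equivclp (cancel_step X) u v" using assms by (auto simp: word_rel_def)
  then show ?thesis by induction (auto dest: step)
qed

lemma word_rel_append_cong:
  assumes u: "(u, u') \<in> word_rel X" and v: "(v, v') \<in> word_rel X"
  shows "(u @ v, u' @ v') \<in> word_rel X"
proof -
  have l: "u \<in> lists (X \<times> UNIV)" "u' \<in> lists (X \<times> UNIV)" "v \<in> lists (X \<times> UNIV)" "v' \<in> lists (X \<times> UNIV)"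
    using u v word_rel_carrier by blast+
  have "equivclp (cancel_step X) u u'" using u by (auto simp: word_rel_def)
  then have 1: "equivclp (cancel_step X) (u @ v) (u' @ v)"
  proof induction
    case (step y z)
    have "cancel_step X (p @ v) (q @ v)" if "cancel_step X p q" for p q
      using that l(3) unfolding cancel_step_def by force
    with step show ?case by (blast intro: equivclp_into_equivclp)
  qed simp
  have "equivclp (cancel_step X) v v'" using v by (auto simp: word_rel_def)
  then have 2: "equivclp (cancel_step X) (u' @ v) (u' @ v')"
  proof induction
    case (step y z)
    have "cancel_step X (u' @ p) (u' @ q)" if c: "cancel_step X p q" for p q
    proof -
      obtain a b x e where "p = a @ [(x, e), (x, \<not> e)] @ b" "q = a @ b" "p \<in> lists (X \<times> UNIV)"
        using c unfolding cancel_step_def by blast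
      then show ?thesis using l(2) unfolding cancel_step_def
        by (intro conjI exI[of _ "u' @ a"] exI[of _ b] exI[of _ x] exI[of _ e]) auto
    qed
    with step show ?case by (blast intro: equivclp_into_equivclp)
  qed simp
  from equivclp_trans[OF 1 2] show ?thesis using l by (auto simp: word_rel_def)
qed

abbreviation word_class :: "'x set \<Rightarrow> ('x \<times> bool) list \<Rightarrow> ('x \<times> bool) list set" where
  "word_class X u \<equiv> word_rel X `` {u}"

lemma word_class_eq_iff:
  assumes "u \<in> lists (X \<times> UNIV)" "v \<in> lists (X \<times> UNIV)"
  shows "word_class X u = word_class X v \<longleftrightarrow> (u, v) \<in> word_rel X"
  using eq_equiv_class_iff[OF word_rel_equiv] assms by blast

lemma free_group_carrier:
  "P \<in> carrier (free_group X) \<longleftrightarrow> (\<exists>u \<in> lists (X \<times> UNIV). P = word_class X u)"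
  by (auto simp: free_group_def quotient_def)

lemma free_group_mult:
  assumes u: "u \<in> lists (X \<times> UNIV)" and v: "v \<in> lists (X \<times> UNIV)"
  shows "word_class X u \<otimes>\<^bsub>free_group X\<^esub> word_class X v = word_class X (u @ v)"
proof -
  have "word_class X (u' @ v') = word_class X (u @ v)"
    if "u' \<in> word_class X u" "v' \<in> word_class X v" for u' v'
    using that word_rel_append_cong[of u u' X v v'] equiv_class_eq[OF word_rel_equiv] by fastforce
  moreover have "u \<in> word_class X u" "v \<in> word_class X v"
    using u v by (auto simp: word_rel_def)
  ultimately have "(\<Union>u'\<in>word_class X u. \<Union>v'\<in>word_class X v. word_class X (u' @ v')) = word_class X (u @ v)"
    by blast
  then show ?thesis by (simp add: free_group_def)
qed

lemma free_group_one: "\<one>\<^bsub>free_group X\<^esub> = word_class X []"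
  by (simp add: free_group_def)

lemma cancel_letter:
  assumes "x \<in> X" shows "word_class X [(x, e), (x, \<not> e)] = word_class X []"
proof -
  have "cancel_step X [(x, e), (x, \<not> e)] []"
    using assms unfolding cancel_step_def by (auto intro!: exI[of _ "[]"])
  from cancel_step_imp_word_rel[OF this] assms show ?thesis by (subst word_class_eq_iff) auto
qed

lemma free_group_inverse:
  "u \<in> lists (X \<times> UNIV) \<Longrightarrow>
    \<exists>v \<in> lists (X \<times> UNIV). word_class X (v @ u) = word_class X [] \<and> word_class X (u @ v) = word_class X []"
proof (induction u)
  case Nil then show ?case by (intro bexI[of _ "[]"]) auto
next
  case (Cons l u)
  obtain x e where l: "l = (x, e)" by force
  from Cons obtain v where v: "v \<in> lists (X \<times> UNIV)" "word_class X (v @ u) = word_class X []"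
    "word_class X (u @ v) = word_class X []" by auto
  have x: "x \<in> X" and u: "u \<in> lists (X \<times> UNIV)" using Cons.prems l by auto
  let ?v = "v @ [(x, \<not> e)]"
  have "cancel_step X (?v @ l # u) (v @ u)"
    unfolding cancel_step_def l using x u v(1)
    by (intro conjI exI[of _ v] exI[of _ u] exI[of _ x] exI[of _ "\<not> e"]) auto
  then have "word_class X (?v @ l # u) = word_class X []"
    using v(2) cancel_step_imp_word_rel equiv_class_eq[OF word_rel_equiv] by metis
  moreover have "((l # u) @ ?v, [(x, e), (x, \<not> e)]) \<in> word_rel X"
  proof -
    have "(u @ v, []) \<in> word_rel X" using v u by (subst word_class_eq_iff[symmetric]) auto
    from word_rel_append_cong[OF _ word_rel_append_cong[OF this], of "[l]" "[l]" "[(x, \<not> e)]" "[(x, \<not> e)]"]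
    show ?thesis using x l equiv_class_self[OF word_rel_equiv] by (auto simp: word_rel_def)
  qed
  then have "word_class X ((l # u) @ ?v) = word_class X []"
    using cancel_letter[OF x, of e] equiv_class_eq[OF word_rel_equiv] by metis
  ultimately show ?case using v(1) x by (intro bexI[of _ ?v]) auto
qed

lemma group_free_group: "group (free_group X)"
proof (rule groupI)
  fix P Q R assume "P \<in> carrier (free_group X)" "Q \<in> carrier (free_group X)" "R \<in> carrier (free_group X)"
  then show "P \<otimes>\<^bsub>free_group X\<^esub> Q \<otimes>\<^bsub>free_group X\<^esub> R = P \<otimes>\<^bsub>free_group X\<^esub> (Q \<otimes>\<^bsub>free_group X\<^esub> R)"
    unfolding free_group_carrier
    by (elim bexE) (simp add: free_group_mult append_in_lists_conv del: in_lists_conv_set)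
next
  fix P assume "P \<in> carrier (free_group X)"
  then obtain u where u: "u \<in> lists (X \<times> UNIV)" "P = word_class X u"
    unfolding free_group_carrier by blast
  from free_group_inverse[OF u(1)] obtain v where
    "v \<in> lists (X \<times> UNIV)" "word_class X (v @ u) = word_class X []" by blast
  with u show "\<exists>Q\<in>carrier (free_group X). Q \<otimes>\<^bsub>free_group X\<^esub> P = \<one>\<^bsub>free_group X\<^esub>"
    by (intro bexI[of _ "word_class X v"])
      (auto simp: free_group_mult free_group_one free_group_carrier simp del: in_lists_conv_set)
next
  fix P Q assume "P \<in> carrier (free_group X)" "Q \<in> carrier (free_group X)"
  then obtain u v where "u \<in> lists (X \<times> UNIV)" "P = word_class X u" "v \<in> lists (X \<times> UNIV)" "Q = word_class X v"
    unfolding free_group_carrier by blast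
  then show "P \<otimes>\<^bsub>free_group X\<^esub> Q \<in> carrier (free_group X)"
    by (auto simp: free_group_mult free_group_carrier simp del: in_lists_conv_set intro!: bexI[of _ "u @ v"])
next
  show "\<one>\<^bsub>free_group X\<^esub> \<in> carrier (free_group X)"
    unfolding free_group_carrier free_group_one by blast
next
  fix P assume "P \<in> carrier (free_group X)"
  then show "\<one>\<^bsub>free_group X\<^esub> \<otimes>\<^bsub>free_group X\<^esub> P = P"
    unfolding free_group_carrier free_group_one
    by (elim bexE) (simp add: free_group_mult del: in_lists_conv_set)
qed

lemma (in group) normal_closure_normal:
  assumes "R \<subseteq> carrier G"
  shows "normal_closure G R \<lhd> G" and "R \<subseteq> normal_closure G R"
    and "\<And>N. N \<lhd> G \<Longrightarrow> R \<subseteq> N \<Longrightarrow> normal_closure G R \<subseteq> N"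
proof -
  have "carrier G \<lhd> G" by (rule normal_invI[OF subgroup_self]) auto
  with assms have ne: "{N. N \<lhd> G \<and> R \<subseteq> N} \<noteq> {}" by blast
  show "normal_closure G R \<lhd> G"
  proof (rule normal_invI)
    show "subgroup (normal_closure G R) G"
      unfolding normal_closure_def
      by (rule subgroups_Inter) (use ne in \<open>auto dest: normal_invE\<close>)
  qed (auto simp: normal_closure_def dest: normal_invE(2))
qed (auto simp: normal_closure_def)

text \<open>The integral of the cochain \<open>\<psi>\<close> along the path that starts at \<open>g\<close> and reads the word \<open>w\<close>.\<close>

primrec path_sum ::
  "('a, 'c) monoid_scheme \<Rightarrow> ('a \<Rightarrow> 'a \<Rightarrow> int) \<Rightarrow> 'a \<Rightarrow> 'a list \<Rightarrow> int" where
  "path_sum G \<psi> g [] = 0"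
| "path_sum G \<psi> g (s # w) = \<psi> g (g \<otimes>\<^bsub>G\<^esub> s) + path_sum G \<psi> (g \<otimes>\<^bsub>G\<^esub> s) w"

lemma (in group) path_sum_append:
  "g \<in> carrier G \<Longrightarrow> set u \<subseteq> carrier G \<Longrightarrow> set v \<subseteq> carrier G \<Longrightarrow>
    path_sum G \<psi> g (u @ v) = path_sum G \<psi> g u + path_sum G \<psi> (g \<otimes> foldr (\<otimes>) u \<one>) v"
proof (induction u arbitrary: g)
  case (Cons s u)
  have "foldr (\<otimes>) u \<one> \<in> carrier G" using Cons.prems(2) by (induction u) auto
  with Cons show ?case by (simp add: m_assoc)
qed simp

text \<open>An antisymmetric \<open>\<psi>\<close> is a 1-cochain on the Cayley graph.  The condition says that the complex obtained
  by filling in all loops of length at most \<open>l\<close> has trivial first cohomology with integer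
  coefficients: a cochain whose integral over every short loop vanishes is exact.\<close>

definition short_loops_suffice :: "('a, 'c) monoid_scheme \<Rightarrow> 'a set \<Rightarrow> nat \<Rightarrow> bool" where
  "short_loops_suffice G S l \<longleftrightarrow>
     (\<forall>\<psi>. (\<forall>x\<in>carrier G. \<forall>y\<in>carrier G. \<psi> y x = - \<psi> x y) \<longrightarrow>
       (\<forall>g\<in>carrier G. \<forall>w. set w \<subseteq> S \<union> m_inv G ` S \<longrightarrow> length w \<le> l \<longrightarrow>
          foldr (mult G) w \<one>\<^bsub>G\<^esub> = \<one>\<^bsub>G\<^esub> \<longrightarrow> path_sum G \<psi> g w = 0) \<longrightarrow>
       (\<forall>g\<in>carrier G. \<forall>w. set w \<subseteq> S \<union> m_inv G ` S \<longrightarrow>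
          foldr (mult G) w \<one>\<^bsub>G\<^esub> = \<one>\<^bsub>G\<^esub> \<longrightarrow> path_sum G \<psi> g w = 0))"

text \<open>Let \<open>l\<close> bound the lengths of the relators.  Among the elements of the free group that are trivial in
  \<open>G\<close>, those along which \<open>\<psi>\<close> integrates to 0 from every starting point form a normal subgroup: in
  the integral along a conjugate the two conjugating paths are traversed in opposite directions and
  cancel.  This subgroup contains the relators, hence all words that are trivial in \<open>G\<close>, that is, all
  loops of the Cayley graph.\<close>

theorem finitely_presented_short_loops:
  fixes G (structure)
  assumes "group G" "finitely_presented G"
  shows "\<exists>S l. finite_generating_set G S \<and> short_loops_suffice G S l"
proof -
  interpret group G by fact
  from assms(2) obtain n :: nat and R h where R: "finite R" "R \<subseteq> carrier (free_group {..<n})"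
    and h: "h \<in> iso G (free_group {..<n} Mod normal_closure (free_group {..<n}) R)"
    unfolding finitely_presented_def is_iso_def by auto
  define X where "X = {..<n}"
  define F where "F = free_group X"
  define N where "N = normal_closure F R"
  define L where "L = lists (X \<times> (UNIV :: bool set))"
  interpret F: group F unfolding F_def by (rule group_free_group)
  have RF: "R \<subseteq> carrier F" using R by (simp add: F_def X_def)
  interpret N: normal N F unfolding N_def by (rule F.normal_closure_normal[OF RF])
  have RN: "R \<subseteq> N" and Nmin: "\<And>K. K \<lhd> F \<Longrightarrow> R \<subseteq> K \<Longrightarrow> N \<subseteq> K"
    unfolding N_def using F.normal_closure_normal[OF RF] by blast+
  have hN: "h \<in> iso G (F Mod N)" using h by (simp add: F_def X_def N_def)
  \<comment> \<open>the projection of the free group onto \<open>G\<close> and, below, the images \<open>a\<close> of the letters under it\<close>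
  define \<pi> where "\<pi> P = inv_into (carrier G) h (N #>\<^bsub>F\<^esub> P)" for P
  interpret Q: group "F Mod N" by (rule N.factorgroup_is_group)
  have i: "inv_into (carrier G) h \<in> iso (F Mod N) G" using hN by (rule iso_set_sym)
  have "inv_into (carrier G) h \<circ> (\<lambda>P. N #>\<^bsub>F\<^esub> P) \<in> hom F G"
    using i by (intro Group.hom_compose[OF N.r_coset_hom_Mod]) (simp add: iso_def)
  then have \<pi>hom: "\<pi> \<in> hom F G" by (simp add: \<pi>_def[abs_def] comp_def)
  interpret \<pi>: group_hom F G \<pi> by unfold_locales (rule \<pi>hom)
  have coset: "N #>\<^bsub>F\<^esub> P \<in> carrier (F Mod N)" if "P \<in> carrier F" for P
    using that by (auto simp: FactGroup_def RCOSETS_def)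
  have ker: "\<pi> P = \<one> \<longleftrightarrow> P \<in> N" if "P \<in> carrier F" for P
  proof -
    have "\<pi> P = \<one> \<longleftrightarrow> N #>\<^bsub>F\<^esub> P = \<one>\<^bsub>F Mod N\<^esub>"
    proof -
      have "inv_into (carrier G) h \<one>\<^bsub>F Mod N\<^esub> = \<one>"
        using i hom_one[of "inv_into (carrier G) h" "F Mod N" G] Q.is_group is_group by (simp add: iso_def)
      moreover have "inj_on (inv_into (carrier G) h) (carrier (F Mod N))"
        using i by (simp add: iso_def bij_betw_def)
      ultimately show ?thesis
        unfolding \<pi>_def using coset[OF that] by (metis inj_onD Q.one_closed)
    qed
    also have "\<dots> \<longleftrightarrow> N #>\<^bsub>F\<^esub> P = N" by (simp add: FactGroup_def)
    also have "\<dots> \<longleftrightarrow> P \<in> N"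
      using that F.coset_join1 F.coset_join2 N.subgroup_axioms by blast
    finally show ?thesis .
  qed
  have surj: "\<exists>P\<in>carrier F. \<pi> P = g" if "g \<in> carrier G" for g
  proof -
    have "h g \<in> carrier (F Mod N)" using hN that by (auto simp: iso_def hom_def)
    then obtain P where "P \<in> carrier F" "h g = N #>\<^bsub>F\<^esub> P"
      by (auto simp: FactGroup_def RCOSETS_def)
    moreover have "inv_into (carrier G) h (h g) = g"
      using hN that by (intro inv_into_f_f) (auto simp: iso_def bij_betw_def)
    ultimately show ?thesis unfolding \<pi>_def by metis
  qed
  define a where "a l = \<pi> (word_class X [l])" for l
  have cls: "word_class X u \<in> carrier F" if "u \<in> L" for u
    using that by (auto simp: F_def free_group_carrier L_def)
  have single: "[l] \<in> L" if "l \<in> X \<times> UNIV" for l using that by (simp add: L_def)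
  have a_closed: "a l \<in> carrier G" if "l \<in> X \<times> UNIV" for l
    unfolding a_def using cls[OF single[OF that]] by simp
  have mult: "word_class X u \<otimes>\<^bsub>F\<^esub> word_class X v = word_class X (u @ v)" if "u \<in> L" "v \<in> L" for u v
    using that by (simp add: F_def L_def free_group_mult)
  have one: "\<one>\<^bsub>F\<^esub> = word_class X []" by (simp add: F_def free_group_one)
  have val: "\<pi> (word_class X u) = foldr (\<otimes>) (map a u) \<one>" if "u \<in> L" for u
    using that
  proof (induction u)
    case Nil then show ?case using \<pi>.hom_one by (simp add: one)
  next
    case (Cons l u)
    then have "l \<in> X \<times> UNIV" "u \<in> L" by (auto simp: L_def)
    then show ?case
      using mult[OF single, of l u] Cons.IH \<pi>.hom_mult[OF cls[OF single] cls, of l u]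
      by (simp add: a_def)
  qed
  have a_inv: "a (x, \<not> e) = inv (a (x, e))" if "x \<in> X" for x e
  proof -
    have "a (x, \<not> e) \<otimes> a (x, e) = \<one>"
      using val[of "[(x, \<not> e), (x, e)]"] cancel_letter[OF that, of "\<not> e"] one \<pi>.hom_one that a_closed
      by (simp add: L_def)
    then show ?thesis using a_closed that by (intro inv_equality[symmetric]) auto
  qed
  define S where "S = (\<lambda>x. a (x, True)) ` X"
  have letters: "S \<union> m_inv G ` S = a ` (X \<times> UNIV)"
  proof -
    have "a (x, False) = inv a (x, True)" if "x \<in> X" for x using a_inv[OF that, of True] by simp
    then show ?thesis unfolding S_def image_image
      by (auto simp: image_iff UNIV_bool intro: rev_bexI)
  qed
  have S: "finite S" "S \<subseteq> carrier G" using a_closed by (auto simp: S_def X_def)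
  have gen: "generate G S = carrier G"
  proof (intro equalityI generate_incl S subsetI)
    fix g assume "g \<in> carrier G"
    then obtain P where "P \<in> carrier F" "\<pi> P = g" using surj by blast
    then obtain u where u: "u \<in> L" "g = foldr (\<otimes>) (map a u) \<one>"
      using val by (auto simp: F_def free_group_carrier L_def)
    have "foldr (\<otimes>) (map a u) \<one> \<in> generate G S" using u(1)
    proof (induction u)
      case (Cons l u)
      then have "a l \<in> S \<union> m_inv G ` S" unfolding letters by (auto simp: L_def)
      then have "a l \<in> generate G S" by (auto intro: generate.intros)
      with Cons show ?case by (auto simp: L_def intro: generate.eng)
    qed (simp add: generate.one)
    with u show "g \<in> generate G S" by simp
  qed
  define rep where "rep r = (SOME w. w \<in> L \<and> r = word_class X w)" for r
  have rep: "rep r \<in> L \<and> r = word_class X (rep r)" if "r \<in> R" for r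
  proof -
    have "\<exists>w. w \<in> L \<and> r = word_class X w"
      using subsetD[OF RF that] free_group_carrier[of r X] unfolding F_def L_def Bex_def by (rule iffD1[rotated])
    then show ?thesis unfolding rep_def by (rule someI_ex)
  qed
  define l where "l = Max (insert 0 ((length \<circ> rep) ` R))"
  have l: "length (rep r) \<le> l" if "r \<in> R" for r
    unfolding l_def using that R(1) by (intro Max_ge) auto
  have "short_loops_suffice G S l"
    unfolding short_loops_suffice_def letters
  proof (intro allI impI ballI)
    fix \<psi> :: "'a \<Rightarrow> 'a \<Rightarrow> int" and g w
    assume anti: "\<forall>x\<in>carrier G. \<forall>y\<in>carrier G. \<psi> y x = - \<psi> x y"
      and short: "\<forall>g\<in>carrier G. \<forall>w. set w \<subseteq> a ` (X \<times> UNIV) \<longrightarrow> length w \<le> l \<longrightarrow>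
          foldr (\<otimes>) w \<one> = \<one> \<longrightarrow> path_sum G \<psi> g w = 0"
      and g: "g \<in> carrier G" and w: "set w \<subseteq> a ` (X \<times> UNIV)" "foldr (\<otimes>) w \<one> = \<one>"
    define I where "I u g = path_sum G \<psi> g (map a u)" for u g
    have map_closed: "set (map a u) \<subseteq> carrier G" if "u \<in> L" for u
      using that a_closed by (auto simp: L_def)
    have \<pi>c: "\<pi> (word_class X u) \<in> carrier G" if "u \<in> L" for u
      using cls[OF that] by simp
    have I_append: "I (u @ v) g = I u g + I v (g \<otimes> \<pi> (word_class X u))"
      if "u \<in> L" "v \<in> L" "g \<in> carrier G" for u v g
      unfolding I_def val[OF that(1)]
      using path_sum_append[OF that(3) map_closed[OF that(1)] map_closed[OF that(2)]] by simp
    have I_cancel: "I [(x, e), (x, \<not> e)] g = 0" if "x \<in> X" "g \<in> carrier G" for x e g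
    proof -
      have a: "a (x, e) \<in> carrier G" using that a_closed by simp
      with that(2) anti have "\<psi> (g \<otimes> a (x, e)) g = - \<psi> g (g \<otimes> a (x, e))" by blast
      then show ?thesis using that a a_inv[of x e] by (simp add: I_def m_assoc)
    qed
    have I_cong: "I u g = I v g" if uv: "(u, v) \<in> word_rel X" and g: "g \<in> carrier G" for u v g
    proof (rule word_rel_invariant[OF uv])
      fix p q x e assume "p @ q \<in> lists (X \<times> (UNIV :: bool set))" and x: "x \<in> X"
      then have pq: "p \<in> L" "q \<in> L" by (auto simp: L_def)
      let ?c = "[(x, e), (x, \<not> e)]"
      have c: "?c \<in> L" using x by (simp add: L_def)
      have cq: "?c @ q \<in> L" using c pq by (simp add: L_def)
      have one': "\<pi> (word_class X ?c) = \<one>"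
        using cancel_letter[OF x, of e] \<pi>.hom_one one by simp
      show "I (p @ ?c @ q) g = I (p @ q) g"
        unfolding I_append[OF pq(1) cq g] I_append[OF pq g]
        using I_append[OF c pq(2), of "g \<otimes> \<pi> (word_class X p)"] I_cancel[OF x, of "g \<otimes> \<pi> (word_class X p)" e]
          g \<pi>c[OF pq(1)] one' by simp
    qed
    \<comment> \<open>the normal subgroup of the words along which \<open>\<psi>\<close> integrates to 0\<close>
    define K where "K = {P \<in> N. \<exists>u\<in>L. P = word_class X u \<and> (\<forall>g\<in>carrier G. I u g = 0)}"
    have KI: "word_class X u \<in> K" if "u \<in> L" "word_class X u \<in> N" "\<And>g. g \<in> carrier G \<Longrightarrow> I u g = 0" for u
      unfolding K_def using that by blast
    have KD: "I u g = 0" if "word_class X u \<in> K" "u \<in> L" "g \<in> carrier G" for u g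
    proof -
      obtain v where v: "v \<in> L" "word_class X u = word_class X v" "\<forall>g\<in>carrier G. I v g = 0"
        using \<open>word_class X u \<in> K\<close> unfolding K_def by blast
      then have "(u, v) \<in> word_rel X" using word_class_eq_iff[of u X v] that(2) by (simp add: L_def)
      with I_cong v(3) that(3) show ?thesis by metis
    qed
    have KE: "\<exists>u\<in>L. P = word_class X u \<and> \<pi> (word_class X u) = \<one> \<and> (\<forall>g\<in>carrier G. I u g = 0)" if "P \<in> K" for P
      using that ker[OF cls] unfolding K_def by blast
    have KN: "K \<subseteq> N" by (auto simp: K_def)
    have appL: "u @ v \<in> L" if "u \<in> L" "v \<in> L" for u v using that by (simp add: L_def)
    have conj: "P \<otimes>\<^bsub>F\<^esub> Q \<otimes>\<^bsub>F\<^esub> inv\<^bsub>F\<^esub> P \<in> K" if P: "P \<in> carrier F" and Q: "Q \<in> K" for P Q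
    proof -
      obtain u where u: "u \<in> L" "P = word_class X u" using P by (auto simp: F_def free_group_carrier L_def)
      obtain u' where u': "u' \<in> L" "inv\<^bsub>F\<^esub> P = word_class X u'"
        using F.inv_closed[OF P] unfolding F_def free_group_carrier L_def by blast
      obtain q where q: "q \<in> L" "Q = word_class X q" "\<pi> (word_class X q) = \<one>" "\<forall>g\<in>carrier G. I q g = 0"
        using KE[OF Q] by blast
      have "word_class X (u @ u') = word_class X []"
        using mult[OF u(1) u'(1)] P u u' one by (metis F.r_inv)
      then have rel: "(u @ u', []) \<in> word_rel X"
        using word_class_eq_iff[of "u @ u'" X "[]"] appL[OF u(1) u'(1)] by (simp add: L_def)
      have "P \<otimes>\<^bsub>F\<^esub> Q \<otimes>\<^bsub>F\<^esub> inv\<^bsub>F\<^esub> P = word_class X u \<otimes>\<^bsub>F\<^esub> word_class X q \<otimes>\<^bsub>F\<^esub> word_class X u'"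
        unfolding u'(2) unfolding u(2) q(2) ..
      also have "\<dots> = word_class X (u @ q @ u')"
        by (simp only: mult[OF u(1) q(1)] mult[OF appL[OF u(1) q(1)] u'(1)] append_assoc)
      finally have conj_eq: "P \<otimes>\<^bsub>F\<^esub> Q \<otimes>\<^bsub>F\<^esub> inv\<^bsub>F\<^esub> P = word_class X (u @ q @ u')" .
      have "word_class X (u @ q @ u') \<in> K"
      proof (rule KI)
        show "word_class X (u @ q @ u') \<in> N"
          using N.inv_op_closed2[OF P subsetD[OF KN Q]] unfolding conj_eq .
        fix g assume g: "g \<in> carrier G"
        let ?g = "g \<otimes> \<pi> (word_class X u)"
        have g': "?g \<in> carrier G" using g \<pi>c u by simp
        have "I (u @ q @ u') g = I u g + (I q ?g + I u' (?g \<otimes> \<one>))"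
          using I_append[OF u(1) appL[OF q(1) u'(1)] g] I_append[OF q(1) u'(1) g'] q(3) by simp
        also have "\<dots> = I (u @ u') g"
          using I_append[OF u(1) u'(1) g] q(4) g' by simp
        also have "\<dots> = I [] g" using I_cong[OF rel g] .
        finally show "I (u @ q @ u') g = 0" by (simp add: I_def)
      qed (use appL u u' q in auto)
      then show ?thesis unfolding conj_eq .
    qed
    have "K \<lhd> F"
    proof (rule F.normal_invI[OF _ conj])
      show "subgroup K F"
      proof (rule F.subgroupI)
        show "K \<subseteq> carrier F" using KN N.subset by blast
        have "word_class X [] \<in> K"
          using N.one_closed by (intro KI) (auto simp: L_def I_def one)
        then show "K \<noteq> {}" by blast
      next
        fix P assume P: "P \<in> K"
        then have PF: "P \<in> carrier F" and PN: "P \<in> N" using KN N.subset by blast+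
        obtain u where u: "u \<in> L" "P = word_class X u" "\<pi> (word_class X u) = \<one>" "\<forall>g\<in>carrier G. I u g = 0"
          using KE[OF P] by blast
        obtain u' where u': "u' \<in> L" "inv\<^bsub>F\<^esub> P = word_class X u'"
          using F.inv_closed[OF PF] unfolding F_def free_group_carrier L_def by blast
        have "word_class X (u @ u') = word_class X []"
          using mult[OF u(1) u'(1)] PF u u' one by (metis F.r_inv)
        then have rel: "(u @ u', []) \<in> word_rel X"
          using word_class_eq_iff[of "u @ u'" X "[]"] appL[OF u(1) u'(1)] by (simp add: L_def)
        have "I u' g = 0" if g: "g \<in> carrier G" for g
          using I_append[OF u(1) u'(1) g] I_cong[OF rel g] u g by (simp add: I_def)
        moreover have "word_class X u' \<in> N" using N.m_inv_closed[OF PN] unfolding u'(2) .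
        ultimately show "inv\<^bsub>F\<^esub> P \<in> K" unfolding u'(2) by (intro KI u'(1))
      next
        fix P Q assume P: "P \<in> K" and Q: "Q \<in> K"
        obtain u where u: "u \<in> L" "P = word_class X u" "\<pi> (word_class X u) = \<one>" "\<forall>g\<in>carrier G. I u g = 0"
          using KE[OF P] by blast
        obtain v where v: "v \<in> L" "Q = word_class X v" "\<forall>g\<in>carrier G. I v g = 0"
          using KE[OF Q] by blast
        have "word_class X (u @ v) \<in> N"
          using N.m_closed[OF subsetD[OF KN P] subsetD[OF KN Q]] mult[OF u(1) v(1)] u(2) v(2) by simp
        then have "word_class X (u @ v) \<in> K"
          using appL[OF u(1) v(1)] I_append[OF u(1) v(1)] u v by (intro KI) auto
        then show "P \<otimes>\<^bsub>F\<^esub> Q \<in> K" using mult[OF u(1) v(1)] u(2) v(2) by simp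
      qed
    qed
    moreover have "R \<subseteq> K"
    proof
      fix r assume r: "r \<in> R"
      have "word_class X (rep r) \<in> K"
      proof (rule KI)
        show repL: "rep r \<in> L" using rep[OF r] by blast
        show N: "word_class X (rep r) \<in> N" using rep[OF r] r RN by auto
        fix g assume "g \<in> carrier G"
        moreover have "set (map a (rep r)) \<subseteq> a ` (X \<times> UNIV)" using rep[OF r] by (auto simp: L_def)
        moreover have "foldr (\<otimes>) (map a (rep r)) \<one> = \<one>"
          using val[OF repL] ker[OF cls[OF repL]] N by simp
        moreover have "length (map a (rep r)) \<le> l" using l[OF r] by simp
        ultimately show "I (rep r) g = 0" unfolding I_def using short by blast
      qed
      with rep[OF r] show "r \<in> K" by simp
    qed
    ultimately have NK: "N \<subseteq> K" by (rule Nmin)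
    have "\<exists>u\<in>L. map a u = w" using w(1)
    proof (induction w)
      case (Cons s w)
      then obtain u l where "u \<in> L" "map a u = w" "l \<in> X \<times> UNIV" "a l = s" by auto
      then show ?case by (intro bexI[of _ "l # u"]) (auto simp: L_def)
    qed (auto simp: L_def)
    then obtain u where u: "u \<in> L" "map a u = w" by blast
    then have "word_class X u \<in> K" using w(2) val[OF u(1)] ker[OF cls[OF u(1)]] NK by auto
    with KD[OF _ u(1) g] u(2) show "path_sum G \<psi> g w = 0" by (simp add: I_def)
  qed
  with S gen show ?thesis unfolding finite_generating_set_def by blast
qed

section \<open>Growth\<close>

definition subexponential :: "(real \<Rightarrow> real) \<Rightarrow> bool" where
  "subexponential v \<longleftrightarrow> (\<forall>\<epsilon>>0. \<forall>\<^sub>F r in at_top. v r \<le> exp (\<epsilon> * r))"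

lemma subexponentialD: "subexponential v \<Longrightarrow> \<epsilon> > 0 \<Longrightarrow> \<forall>\<^sub>F r in at_top. v r \<le> exp (\<epsilon> * r)"
  by (simp add: subexponential_def)

lemma subexponential_mult:
  assumes "subexponential u" "subexponential v" "\<And>r. 0 \<le> u r" "\<And>r. 0 \<le> v r"
  shows "subexponential (\<lambda>r. u r * v r)"
  unfolding subexponential_def
proof (intro allI impI)
  fix \<epsilon> :: real assume "\<epsilon> > 0"
  then have "\<forall>\<^sub>F r in at_top. u r \<le> exp (\<epsilon> / 2 * r)" "\<forall>\<^sub>F r in at_top. v r \<le> exp (\<epsilon> / 2 * r)"
    using assms(1,2) half_gt_zero unfolding subexponential_def by blast+
  then show "\<forall>\<^sub>F r in at_top. u r * v r \<le> exp (\<epsilon> * r)"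
  proof eventually_elim
    case (elim r)
    then have "u r * v r \<le> exp (\<epsilon> / 2 * r) * exp (\<epsilon> / 2 * r)"
      using assms(3,4) by (intro mult_mono) auto
    also have "\<dots> = exp (\<epsilon> * r)" by (simp add: exp_add[symmetric])
    finally show ?case .
  qed
qed

lemma subexponential_const: "subexponential (\<lambda>_. c)"
  unfolding subexponential_def
proof (intro allI impI)
  fix \<epsilon> :: real assume e: "\<epsilon> > 0"
  show "\<forall>\<^sub>F r in at_top. c \<le> exp (\<epsilon> * r)"
    using eventually_ge_at_top[of "\<bar>c\<bar> / \<epsilon>"]
  proof eventually_elim
    case (elim r)
    then have "c \<le> \<epsilon> * r" using e by (simp add: field_simps)
    also have "\<dots> \<le> exp (\<epsilon> * r)" using exp_ge_add_one_self[of "\<epsilon> * r"] by linarith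
    finally show ?case .
  qed
qed

lemma subexponential_power:
  assumes "subexponential v" "\<And>r. 0 \<le> v r" shows "subexponential (\<lambda>r. v r ^ n)"
proof (induction n)
  case 0 then show ?case using subexponential_const[of 1] by simp
next
  case (Suc n) then show ?case using subexponential_mult[OF assms(1) Suc] assms(2) by simp
qed

lemma subexponential_affine:
  assumes v: "subexponential v" and "c > 0" "b \<ge> 0"
  shows "subexponential (\<lambda>r. v (c * r + b))"
  unfolding subexponential_def
proof (intro allI impI)
  fix \<epsilon> :: real assume e: "\<epsilon> > 0"
  have "filterlim (\<lambda>r. b + c * r) at_top at_top"
    by (intro filterlim_tendsto_add_at_top[OF tendsto_const]
        filterlim_tendsto_pos_mult_at_top[OF tendsto_const assms(2) filterlim_ident])
  then have "filterlim (\<lambda>r. c * r + b) at_top at_top" by (simp add: add.commute)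
  moreover have "\<forall>\<^sub>F t in at_top. v t \<le> exp (\<epsilon> / (2 * c) * t)"
    using e assms(2) by (intro subexponentialD[OF v]) simp
  ultimately have "\<forall>\<^sub>F r in at_top. v (c * r + b) \<le> exp (\<epsilon> / (2 * c) * (c * r + b))"
    by (rule eventually_compose_filterlim[rotated])
  then show "\<forall>\<^sub>F r in at_top. v (c * r + b) \<le> exp (\<epsilon> * r)"
    using eventually_ge_at_top[of "b / c"]
  proof eventually_elim
    case (elim r)
    then have "c * r + b \<le> 2 * c * r" using assms(2) by (simp add: field_simps)
    then have "\<epsilon> / (2 * c) * (c * r + b) \<le> \<epsilon> / (2 * c) * (2 * c * r)"
      using e assms(2) by (intro mult_left_mono) auto
    also have "\<dots> = \<epsilon> * r" using assms(2) by simp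
    finally show ?case using elim(1) by (meson exp_le_cancel_iff order_trans)
  qed
qed

context marked_group
begin

lemma growth_rate_zero:
  assumes "growth_rate G S = 0" shows "subexponential (\<lambda>r. real (growth r))"
  unfolding subexponential_def
proof (intro allI impI)
  fix \<epsilon> :: real assume "\<epsilon> > 0"
  then have "Limsup at_top (\<lambda>r::real. ereal (ln (real (growth r)) / r)) < ereal \<epsilon>"
    using assms by (simp add: growth_rate_def)
  from Limsup_lessD[OF this] show "\<forall>\<^sub>F r in at_top. real (growth r) \<le> exp (\<epsilon> * r)"
    using eventually_gt_at_top[of 0]
  proof eventually_elim
    case (elim r)
    then have "ln (real (growth r)) \<le> \<epsilon> * r" by (simp add: field_simps)
    then have "exp (ln (real (growth r))) \<le> exp (\<epsilon> * r)" by (simp only: exp_le_cancel_iff)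
    moreover have "exp (ln (real (growth r))) = real (growth r)"
      using growth_pos[of r] elim(2) by (intro exp_ln) simp
    ultimately show ?case by simp
  qed
qed

lemma growth_rate_pos:
  assumes "growth_rate G S > 0" shows "\<exists>\<alpha>>0. \<forall>r0. \<exists>r\<ge>r0. exp (\<alpha> * r) \<le> growth r"
proof -
  obtain \<alpha> where \<alpha>: "0 < ereal \<alpha>" "ereal \<alpha> < growth_rate G S"
    using ereal_dense2[OF assms] by blast
  have "\<exists>r\<ge>r0. exp (\<alpha> * r) \<le> growth r" for r0
  proof (rule ccontr)
    assume neg: "\<not> ?thesis"
    have "\<forall>\<^sub>F r in at_top. ereal (ln (real (growth r)) / r) \<le> ereal \<alpha>"
      using eventually_ge_at_top[of r0] eventually_gt_at_top[of 0]
    proof eventually_elim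
      case (elim r)
      then have "real (growth r) \<le> exp (\<alpha> * r)" using neg by (meson linear)
      then have "ln (real (growth r)) \<le> \<alpha> * r"
        using growth_pos[of r] elim(2) ln_mono[of "real (growth r)" "exp (\<alpha> * r)"] by simp
      then show ?case using elim by (simp add: field_simps)
    qed
    then have "growth_rate G S \<le> ereal \<alpha>"
      unfolding growth_rate_def by (rule Limsup_bounded)
    with \<alpha> show False by simp
  qed
  with \<alpha> show ?thesis by auto
qed

text \<open>The generating sets that witness exponential growth and define the ball differ only by a rescaling
  of the radius, under which subexponential functions stay subexponential.\<close>

lemma exponential_growth_exceeds:
  assumes G: "exponential_growth G" and v: "subexponential v"
  shows "\<exists>r\<ge>0. v r < growth r"
proof -
  obtain S' where S': "finite_generating_set G S'" "growth_rate G S' > 0"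
    using G unfolding exponential_growth_def by blast
  interpret M': marked_group G S' by unfold_locales (rule S'(1))
  obtain \<alpha> where \<alpha>: "\<alpha> > 0" "\<And>r0. \<exists>r\<ge>r0. exp (\<alpha> * r) \<le> M'.growth r"
    using M'.growth_rate_pos[OF S'(2)] by blast
  obtain c where c: "c > 0" "\<forall>x\<in>carrier G. \<forall>y\<in>carrier G. wd x y \<le> c * M'.wd x y"
    using word_dist_bilipschitz[OF marked_group_axioms M'.marked_group_axioms] by blast
  have "subexponential (\<lambda>r. v (c * r + 0))" by (rule subexponential_affine) (use v c in auto)
  then have "\<forall>\<^sub>F r in at_top. v (c * r) \<le> exp (\<alpha> / 2 * r)"
    using subexponentialD[OF _ half_gt_zero[OF \<alpha>(1)]] by fastforce
  then obtain r0 where r0: "\<And>r. r \<ge> r0 \<Longrightarrow> v (c * r) \<le> exp (\<alpha> / 2 * r)"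
    by (auto simp: eventually_at_top_linorder)
  obtain r where r: "r \<ge> max r0 1" "exp (\<alpha> * r) \<le> M'.growth r" using \<alpha>(2) by blast
  have "ball_on (carrier G) M'.wd \<one> r \<subseteq> ball_on (carrier G) wd \<one> (c * r)"
  proof
    fix y assume "y \<in> ball_on (carrier G) M'.wd \<one> r"
    then have y: "y \<in> carrier G" "M'.wd \<one> y \<le> r" by (auto simp: ball_on_def)
    then have "wd \<one> y \<le> c * M'.wd \<one> y" using c by blast
    also have "\<dots> \<le> c * r" using y c by simp
    finally show "y \<in> ball_on (carrier G) wd \<one> (c * r)" using y by (simp add: ball_on_def)
  qed
  then have "M'.growth r \<le> growth (c * r)" by (intro card_mono finite_ball) auto
  moreover have "v (c * r) \<le> exp (\<alpha> / 2 * r)" using r r0 by simp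
  moreover have "exp (\<alpha> / 2 * r) < exp (\<alpha> * r)" using \<alpha>(1) r by simp
  ultimately have "v (c * r) < growth (c * r)" using r(2) by linarith
  then show ?thesis using c r by (intro exI[of _ "c * r"]) auto
qed

end

section \<open>Coarse components\<close>

lemma successively_imp_rtrancl:
  "p \<noteq> [] \<Longrightarrow> set p \<subseteq> Y \<Longrightarrow> successively (\<lambda>u v. d u v \<le> k) p \<Longrightarrow>
    (hd p, last p) \<in> {(x, y). x \<in> Y \<and> y \<in> Y \<and> d x y \<le> k}\<^sup>*"
proof (induction p)
  case (Cons x p)
  show ?case
  proof (cases p)
    case (Cons y q)
    with Cons.IH Cons.prems show ?thesis by (auto intro: converse_rtrancl_into_rtrancl)
  qed simp
qed simp

lemma rtrancl_imp_successively:
  "(u, v) \<in> {(x, y). x \<in> Y \<and> y \<in> Y \<and> d x y \<le> k}\<^sup>* \<Longrightarrow> u \<in> Y \<Longrightarrow>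
    \<exists>p. p \<noteq> [] \<and> hd p = u \<and> last p = v \<and> set p \<subseteq> Y \<and> successively (\<lambda>u v. d u v \<le> k) p"
proof (induction rule: rtrancl_induct)
  case base then show ?case by (intro exI[of _ "[u]"]) auto
next
  case (step y z)
  then obtain p where "p \<noteq> []" "hd p = u" "last p = y" "set p \<subseteq> Y" "successively (\<lambda>u v. d u v \<le> k) p"
    by blast
  with step.hyps(2) show ?case
    by (intro exI[of _ "p @ [z]"]) (auto simp: successively_append_iff)
qed

text \<open>The component is the set of points that are reachable from \<open>u\<close> by \<open>k\<close>-paths in \<open>Y\<close>.\<close>

lemma ex_coarse_component:
  assumes sym: "\<And>x y. x \<in> Y \<Longrightarrow> y \<in> Y \<Longrightarrow> d x y = d y x" and u: "u \<in> Y"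
  shows "\<exists>C \<in> coarse_components d k Y. u \<in> C"
proof -
  define R where "R = {(x, y). x \<in> Y \<and> y \<in> Y \<and> d x y \<le> k}"
  define C where "C = R\<^sup>* `` {u}"
  have "sym R" unfolding R_def sym_def using sym by auto
  then have symR: "sym (R\<^sup>*)" by (rule sym_rtrancl)
  have CY: "C \<subseteq> Y"
  proof
    fix v assume "v \<in> C"
    then have "(u, v) \<in> R\<^sup>*" by (simp add: C_def)
    then show "v \<in> Y" by cases (use u in \<open>auto simp: R_def\<close>)
  qed
  have "\<exists>p. p \<noteq> [] \<and> hd p = x \<and> last p = y \<and> set p \<subseteq> C \<and> successively (\<lambda>u v. d u v \<le> k) p"
    if x: "x \<in> C" and y: "y \<in> C" for x y
  proof (rule rtrancl_imp_successively[OF _ x])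
    have "(x, y) \<in> R\<^sup>*" using x y symR unfolding C_def by (auto dest: symD intro: rtrancl_trans)
    then show "(x, y) \<in> {(x, y). x \<in> C \<and> y \<in> C \<and> d x y \<le> k}\<^sup>*"
    proof induction
      case (step y z)
      have "(u, y) \<in> R\<^sup>*" using x step.hyps(1) by (auto simp: C_def intro: rtrancl_trans)
      then have "y \<in> C" "z \<in> C" using step.hyps(2) by (auto simp: C_def)
      with step show ?case by (auto simp: R_def intro: rtrancl_into_rtrancl)
    qed simp
  qed
  then have conn: "coarsely_connected d k C" unfolding coarsely_connected_def by blast
  have "C' = C" if C': "C \<subseteq> C'" "C' \<subseteq> Y" "coarsely_connected d k C'" for C'
  proof (intro equalityI C'(1) subsetI)
    fix y assume y: "y \<in> C'"
    have "u \<in> C'" using C'(1) by (auto simp: C_def)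
    then obtain p where p: "p \<noteq> []" "hd p = u" "last p = y" "set p \<subseteq> C'"
      "successively (\<lambda>u v. d u v \<le> k) p"
      using C'(3) y unfolding coarsely_connected_def by blast
    have "set p \<subseteq> Y" using p(4) C'(2) by blast
    from successively_imp_rtrancl[OF p(1) this p(5)] p show "y \<in> C" by (simp add: C_def R_def)
  qed
  with conn CY have "C \<in> coarse_components d k Y" by (auto simp: coarse_components_def)
  then show ?thesis by (auto simp: C_def)
qed

lemma dist_to_ge_iff: "ennreal D \<le> dist_to d x Z \<longleftrightarrow> (\<forall>z\<in>Z. ennreal D \<le> ennreal (d x z))"
  by (simp add: dist_to_def le_INF_iff)

lemma nbhdI: "x \<in> M \<Longrightarrow> c \<in> C \<Longrightarrow> d x c \<le> R \<Longrightarrow> x \<in> nbhd M d C R"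
  unfolding nbhd_def dist_to_def by (auto intro!: INF_lower2 ennreal_leI)

section \<open>Distances in graphs\<close>

locale connected_graph =
  fixes V :: "'v set" and E :: "('v \<times> 'v) set"
  assumes graph: "connected_bounded_degree_graph V E"
begin

abbreviation gd :: "'v \<Rightarrow> 'v \<Rightarrow> real" where "gd \<equiv> graph_dist E"

lemma gd_le: "(u, v) \<in> E ^^ n \<Longrightarrow> gd u v \<le> n"
  unfolding graph_dist_def by (simp add: Least_le)

lemma gd_attained: "u \<in> V \<Longrightarrow> v \<in> V \<Longrightarrow> \<exists>n. (u, v) \<in> E ^^ n \<and> gd u v = n"
proof -
  assume "u \<in> V" "v \<in> V"
  then have "\<exists>n. (u, v) \<in> E ^^ n"
    using graph by (auto simp: connected_bounded_degree_graph_def rtrancl_power)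
  from LeastI_ex[OF this] show ?thesis by (auto simp: graph_dist_def)
qed

lemma gd_nonneg [simp]: "0 \<le> gd u v" by (simp add: graph_dist_def)

lemma gd_refl [simp]: "gd u u = 0" using gd_le[of u u 0] gd_nonneg[of u u] by simp

lemma gd_sym: assumes "u \<in> V" "v \<in> V" shows "gd u v = gd v u"
proof -
  have "sym E" using graph by (simp add: connected_bounded_degree_graph_def)
  have "(x, y) \<in> E ^^ n \<Longrightarrow> (y, x) \<in> E ^^ n" for x y n
  proof (induction n arbitrary: x y)
    case (Suc n)
    then obtain z where "(x, z) \<in> E ^^ n" "(z, y) \<in> E" by auto
    with Suc.IH symD[OF \<open>sym E\<close>] show ?case by (blast intro: relpow_Suc_I2)
  qed simp
  then have "(x, y) \<in> E ^^ n \<longleftrightarrow> (y, x) \<in> E ^^ n" for x y n by blast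
  then show ?thesis by (simp add: graph_dist_def)
qed

lemma gd_triangle: "u \<in> V \<Longrightarrow> v \<in> V \<Longrightarrow> w \<in> V \<Longrightarrow> gd u w \<le> gd u v + gd v w"
proof -
  assume "u \<in> V" "v \<in> V" "w \<in> V"
  then obtain m n where mn: "(u, v) \<in> E ^^ m" "gd u v = m" "(v, w) \<in> E ^^ n" "gd v w = n"
    using gd_attained by metis
  then have "(u, w) \<in> E ^^ (m + n)" by (auto simp: relpow_add)
  from gd_le[OF this] mn show ?thesis by simp
qed

lemma graph_coarsely_connected: "coarsely_connected gd 1 V"
  unfolding coarsely_connected_def
proof (intro ballI)
  fix x y assume xy: "x \<in> V" "y \<in> V"
  have sub: "E \<subseteq> {(x, y). x \<in> V \<and> y \<in> V \<and> gd x y \<le> 1}"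
    using graph gd_le[of _ _ 1] by (auto simp: connected_bounded_degree_graph_def)
  have "(x, y) \<in> E\<^sup>*" using graph xy by (auto simp: connected_bounded_degree_graph_def)
  then have "(x, y) \<in> {(x, y). x \<in> V \<and> y \<in> V \<and> gd x y \<le> 1}\<^sup>*"
    using rtrancl_mono[OF sub] by blast
  from rtrancl_imp_successively[OF this xy(1)]
  show "\<exists>p. p \<noteq> [] \<and> hd p = x \<and> last p = y \<and> set p \<subseteq> V \<and> successively (\<lambda>u v. gd u v \<le> 1) p" .
qed

end

section \<open>Families of subexponential growth do not separate\<close>

text \<open>For a separating family the volume would be at least a multiple of \<open>exp (C * t)\<close> at every radius \<open>t\<close>,
  whereas \<open>w t \<le> exp (C / 2 * t)\<close> for large \<open>t\<close>.\<close>

lemma slow_family_not_separating: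
  assumes M: "\<forall>\<S>. coarsely_separates V (graph_dist E) \<S> \<longrightarrow>
              gtrsim (family_volume V E \<S>) (\<lambda>r. ennreal (exp r))"
    and w: "subexponential w"
    and vol: "\<And>S s r. S \<in> \<S> \<Longrightarrow> s \<in> S \<Longrightarrow> 0 \<le> r \<Longrightarrow> real (card (ball_on V (graph_dist E) s r \<inter> S)) \<le> w r"
  shows "\<not> coarsely_separates V (graph_dist E) \<S>"
proof
  assume "coarsely_separates V (graph_dist E) \<S>"
  then obtain C where C: "C > 0" "\<And>t. t \<ge> 0 \<Longrightarrow>
      family_volume V E \<S> t \<ge> ennreal C * ennreal (exp (C * t + C)) + ennreal C"
    using M unfolding gtrsim_def by blast
  have low: "C * exp (C * t + C) \<le> w t" if "t \<ge> 0" for t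
  proof -
    have "ennreal (C * exp (C * t + C) + C) = ennreal C * ennreal (exp (C * t + C)) + ennreal C"
      using C(1) by (simp add: ennreal_mult ennreal_plus)
    also have "\<dots> \<le> family_volume V E \<S> t" by (rule C(2)[OF that])
    also have "\<dots> \<le> ennreal (w t)"
      unfolding family_volume_def
    proof (intro SUP_least)
      fix S s assume "S \<in> \<S>" "s \<in> S"
      from ennreal_leI[OF vol[OF this that]]
      show "of_nat (card (ball_on V (graph_dist E) s t \<inter> S)) \<le> ennreal (w t)"
        by (simp add: ennreal_of_nat_eq_real_of_nat)
    qed
    finally have "C * exp (C * t + C) + C \<le> w t \<or> C * exp (C * t + C) + C \<le> 0"
      by (auto simp: ennreal_le_iff2)
    moreover have "0 < C * exp (C * t + C) + C" using C(1) by (intro add_pos_pos) auto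
    ultimately have "C * exp (C * t + C) + C \<le> w t" by linarith
    with C(1) show ?thesis by simp
  qed
  have "\<forall>\<^sub>F t in at_top. w t \<le> exp (C / 2 * t)"
    by (rule subexponentialD[OF w]) (use C in simp)
  moreover have "\<forall>\<^sub>F t in at_top. 1 / C \<le> exp (C / 2 * t)"
    by (rule subexponentialD[OF subexponential_const]) (use C in simp)
  ultimately have "\<forall>\<^sub>F t::real in at_top. False"
    using eventually_ge_at_top[of 0]
  proof eventually_elim
    case (elim t)
    have "C * exp (C * t + C) \<le> exp (C / 2 * t)" using low[OF elim(3)] elim(1) by simp
    also have "\<dots> \<le> exp (C / 2 * t) * (C * exp (C / 2 * t))"
      using elim(2) C(1) by (simp add: field_simps)
    also have "\<dots> = C * exp (C * t)" by (simp add: exp_add[symmetric])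
    also have "\<dots> < C * exp (C * t + C)" using C(1) by simp
    finally show False by simp
  qed
  then show False by simp
qed

lemma not_coarsely_separatesD:
  assumes "\<not> coarsely_separates M d \<S>" "\<S> \<subseteq> Pow M" "coarsely_connected d k M" "0 \<le> k" "0 \<le> L"
  shows "\<exists>D\<ge>0. \<forall>Z\<in>\<S>. \<forall>C1 \<in> coarse_components d k (M - nbhd M d Z L).
      \<forall>C2 \<in> coarse_components d k (M - nbhd M d Z L).
      \<forall>x\<in>C1. \<forall>y\<in>C2. ennreal D \<le> dist_to d x Z \<longrightarrow> ennreal D \<le> dist_to d y Z \<longrightarrow> C1 = C2"
proof -
  let ?P = "\<lambda>D. \<exists>Z\<in>\<S>. \<exists>C1 \<in> coarse_components d k (M - nbhd M d Z L).
      \<exists>C2 \<in> coarse_components d k (M - nbhd M d Z L).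
      C1 \<noteq> C2 \<and> (\<exists>x\<in>C1. dist_to d x Z \<ge> ennreal D) \<and> (\<exists>x\<in>C2. dist_to d x Z \<ge> ennreal D)"
  have "\<not> (\<forall>D\<ge>0. ?P D)"
  proof
    assume "\<forall>D\<ge>0. ?P D"
    with assms(2-5) have "coarsely_separates M d \<S>"
      unfolding coarsely_separates_def by (intro conjI exI[of _ k] exI[of _ L])
    with assms(1) show False ..
  qed
  then obtain D where D: "0 \<le> D" "\<not> ?P D" by (auto simp only: not_all not_imp)
  show ?thesis
  proof (intro exI[of _ D] conjI D(1) ballI impI)
    fix Z C1 C2 x y
    assume *: "Z \<in> \<S>" "C1 \<in> coarse_components d k (M - nbhd M d Z L)"
      "C2 \<in> coarse_components d k (M - nbhd M d Z L)"
      "x \<in> C1" "y \<in> C2" "ennreal D \<le> dist_to d x Z" "ennreal D \<le> dist_to d y Z"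
    show "C1 = C2"
    proof (rule ccontr)
      assume "C1 \<noteq> C2"
      with * have "?P D" by (intro bexI[of _ Z] bexI[of _ C1] bexI[of _ C2] conjI bexI[of _ x] bexI[of _ y])
      with D(2) show False ..
    qed
  qed
qed

context marked_group
begin

definition edges_avoiding :: "'a set \<Rightarrow> ('a \<times> 'a) set" where
  "edges_avoiding Z = {(x, x \<otimes> s) | x s. x \<in> carrier G - Z \<and> s \<in> letters \<and> x \<otimes> s \<notin> Z}"

lemma short_path_avoiding:
  assumes "x \<in> carrier G" "y \<in> carrier G" "Z \<subseteq> carrier G" "\<forall>z\<in>Z. wd x y < wd x z"
  shows "(x, y) \<in> (edges_avoiding Z)\<^sup>*"
proof -
  have *: "(x, x \<otimes> word_prod w) \<in> (edges_avoiding Z)\<^sup>*"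
    if "x \<in> carrier G" "set w \<subseteq> letters" "\<forall>z\<in>Z. length w < wd x z" for x w
    using that
  proof (induction w arbitrary: x)
    case (Cons s w)
    have s: "s \<in> letters" "s \<in> carrier G" and w: "word_prod w \<in> carrier G" "set w \<subseteq> letters"
      using Cons.prems letters_closed letters_carrier[of w] by auto
    have far: "length w < wd (x \<otimes> s) z" if "z \<in> Z" for z
    proof -
      have "wd x z \<le> wd x (x \<otimes> s) + wd (x \<otimes> s) z"
        using that Cons.prems(1) s assms(3) by (intro wd_triangle) auto
      moreover have "length (s # w) < wd x z" using Cons.prems(3) that by blast
      ultimately show ?thesis using wd_letter[OF Cons.prems(1) s(1)] by simp
    qed
    have "x \<notin> Z" using Cons.prems(1,3) by (auto dest!: bspec[of Z _ x])
    moreover have "x \<otimes> s \<notin> Z"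
    proof
      assume "x \<otimes> s \<in> Z"
      from far[OF this] show False using Cons.prems(1) s by simp
    qed
    ultimately have "(x, x \<otimes> s) \<in> edges_avoiding Z"
      using Cons.prems(1) s by (auto simp: edges_avoiding_def)
    moreover have "(x \<otimes> s, x \<otimes> s \<otimes> word_prod w) \<in> (edges_avoiding Z)\<^sup>*"
      using Cons.IH[of "x \<otimes> s"] far Cons.prems(1) s w by simp
    ultimately show ?case
      using Cons.prems(1) s w by (auto simp: m_assoc intro: converse_rtrancl_into_rtrancl)
  qed simp
  obtain w where w: "set w \<subseteq> letters" "x \<otimes> word_prod w = y" "real (length w) = wd x y"
    using geodesic[OF assms(1,2)] by blast
  from *[OF assms(1) w(1)] show ?thesis using w(2,3) assms(4) by simp
qed

text \<open>The graph that witnesses \<open>group_in_M_exp\<close> is quasi-isometric to \<open>G\<close> for some other word metric; both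
  this change of metric and the two inequalities of a quasi-isometry are absorbed into one
  multiplicative constant \<open>a\<close> and one additive constant \<open>b\<close>.\<close>

lemma quasi_isometric_graph:
  assumes "group_in_M_exp G"
  shows "\<exists>(V::nat set) E q a b. connected_bounded_degree_graph V E \<and>
     (\<forall>\<S>. coarsely_separates V (graph_dist E) \<S> \<longrightarrow>
              gtrsim (family_volume V E \<S>) (\<lambda>r. ennreal (exp r))) \<and>
     a > 0 \<and> b \<ge> 0 \<and> q \<in> carrier G \<rightarrow> V \<and>
     (\<forall>x\<in>carrier G. \<forall>y\<in>carrier G. graph_dist E (q x) (q y) \<le> a * wd x y + b \<and>
         wd x y \<le> a * (graph_dist E (q x) (q y) + b)) \<and>
     (\<forall>v\<in>V. \<exists>x\<in>carrier G. graph_dist E (q x) v \<le> b)"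
proof -
  obtain S' where S': "finite_generating_set G S'" "in_M_exp (carrier G) (word_dist G S')"
    using assms unfolding group_in_M_exp_def by blast
  interpret M': marked_group G S' by unfold_locales (rule S'(1))
  obtain c where c: "c > 0" "\<forall>x\<in>carrier G. \<forall>y\<in>carrier G. wd x y \<le> c * M'.wd x y"
    using word_dist_bilipschitz[OF marked_group_axioms M'.marked_group_axioms] by blast
  obtain c' where c': "c' > 0" "\<forall>x\<in>carrier G. \<forall>y\<in>carrier G. M'.wd x y \<le> c' * wd x y"
    using word_dist_bilipschitz[OF M'.marked_group_axioms marked_group_axioms] by blast
  obtain V :: "nat set" and E where VE: "connected_bounded_degree_graph V E"
    and qi: "quasi_isometric (carrier G) M'.wd V (graph_dist E)"
    and sep: "\<forall>\<S>. coarsely_separates V (graph_dist E) \<S> \<longrightarrow>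
              gtrsim (family_volume V E \<S>) (\<lambda>r. ennreal (exp r))"
    using S'(2) unfolding in_M_exp_def by blast
  obtain q a b where q: "q \<in> carrier G \<rightarrow> V" and a: "a \<ge> 1" and b: "b \<ge> 0"
    and low: "\<And>x y. x \<in> carrier G \<Longrightarrow> y \<in> carrier G \<Longrightarrow> M'.wd x y / a - b \<le> graph_dist E (q x) (q y)"
    and up: "\<And>x y. x \<in> carrier G \<Longrightarrow> y \<in> carrier G \<Longrightarrow> graph_dist E (q x) (q y) \<le> a * M'.wd x y + b"
    and dense: "\<forall>v\<in>V. \<exists>x\<in>carrier G. graph_dist E (q x) v \<le> b"
    using qi unfolding quasi_isometric_def by blast
  interpret X: connected_graph V E by unfold_locales (rule VE)
  define m where "m = max (a * c') (c * a)"
  have "graph_dist E (q x) (q y) \<le> m * wd x y + b \<and> wd x y \<le> m * (graph_dist E (q x) (q y) + b)"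
    if xy: "x \<in> carrier G" "y \<in> carrier G" for x y
  proof
    have "a * M'.wd x y \<le> a * (c' * wd x y)" using c'(2) xy a by (intro mult_left_mono) auto
    also have "\<dots> \<le> m * wd x y" unfolding mult.assoc[symmetric] by (intro mult_right_mono) (auto simp: m_def)
    finally show "graph_dist E (q x) (q y) \<le> m * wd x y + b" using up[OF xy] by simp
    have "M'.wd x y \<le> a * (graph_dist E (q x) (q y) + b)"
      using low[OF xy] a by (simp add: field_simps)
    then have "c * M'.wd x y \<le> c * (a * (graph_dist E (q x) (q y) + b))"
      using c(1) by simp
    also have "\<dots> \<le> m * (graph_dist E (q x) (q y) + b)"
      unfolding mult.assoc[symmetric] using b by (intro mult_right_mono) (auto simp: m_def)
    finally show "wd x y \<le> m * (graph_dist E (q x) (q y) + b)" using c(2) xy by force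
  qed
  moreover have "m > 0" using a c' by (simp add: m_def less_max_iff_disj)
  ultimately show ?thesis using VE sep b q dense by blast
qed

text \<open>Let \<open>q\<close> be a quasi-isometry to a graph in which families of subexponential growth do not separate.
  The sets \<open>q ` Z\<close> form such a family, so for \<open>x\<close> and \<open>y\<close> far from \<open>Z\<close> the points \<open>q x\<close> and \<open>q y\<close> are
  joined by a path outside the \<open>L\<close>-neighbourhood of \<open>q ` Z\<close>.  Each vertex of that path is \<open>b\<close>-close to
  the image of a point of \<open>G\<close>; consecutive such points have bounded distance, and if \<open>L\<close> is large the
  geodesics between them miss \<open>Z\<close>.\<close>

theorem far_points_connected:
  assumes M: "group_in_M_exp G" and v: "subexponential v"
    and \<Z>: "\<And>Z. Z \<in> \<Z> \<Longrightarrow> Z \<subseteq> carrier G"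
    and vol: "\<And>Z z r. Z \<in> \<Z> \<Longrightarrow> z \<in> Z \<Longrightarrow> 0 \<le> r \<Longrightarrow> real (card (ball_on (carrier G) wd z r \<inter> Z)) \<le> v r"
  shows "\<exists>D\<ge>0. \<forall>Z\<in>\<Z>. \<forall>x\<in>carrier G. \<forall>y\<in>carrier G.
    (\<forall>z\<in>Z. D \<le> wd x z) \<longrightarrow> (\<forall>z\<in>Z. D \<le> wd y z) \<longrightarrow> (x, y) \<in> (edges_avoiding Z)\<^sup>*"
proof -
  obtain V :: "nat set" and E q a b where VE: "connected_bounded_degree_graph V E"
    and sep: "\<forall>\<S>. coarsely_separates V (graph_dist E) \<S> \<longrightarrow>
              gtrsim (family_volume V E \<S>) (\<lambda>r. ennreal (exp r))"
    and a: "a > 0" and b: "b \<ge> 0" and q: "q \<in> carrier G \<rightarrow> V"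
    and qi: "\<forall>x\<in>carrier G. \<forall>y\<in>carrier G. graph_dist E (q x) (q y) \<le> a * wd x y + b \<and>
         wd x y \<le> a * (graph_dist E (q x) (q y) + b)"
    and dense: "\<forall>v\<in>V. \<exists>x\<in>carrier G. graph_dist E (q x) v \<le> b"
    using quasi_isometric_graph[OF M] by blast
  interpret X: connected_graph V E by unfold_locales (rule VE)
  have qV: "q x \<in> V" if "x \<in> carrier G" for x using q that by auto
  have up: "X.gd (q x) (q y) \<le> a * wd x y + b" and low: "wd x y \<le> a * (X.gd (q x) (q y) + b)"
    if "x \<in> carrier G" "y \<in> carrier G" for x y using qi that by auto
  define \<S> where "\<S> = (\<lambda>Z. q ` Z) ` \<Z>"
  have "\<not> coarsely_separates V X.gd \<S>"
  proof (rule slow_family_not_separating[OF sep])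
    show "subexponential (\<lambda>r. v (a * r + a * b))"
      using subexponential_affine[OF v a, of "a * b"] a b by simp
    fix S s and r :: real assume S: "S \<in> \<S>" and s: "s \<in> S" and r: "0 \<le> r"
    obtain Z where Z: "Z \<in> \<Z>" "S = q ` Z" using S by (auto simp: \<S>_def)
    then obtain z where z: "z \<in> Z" "s = q z" using s by auto
    have zG: "z \<in> carrier G" using z Z \<Z> by blast
    let ?B = "ball_on (carrier G) wd z (a * r + a * b) \<inter> Z"
    have "ball_on V X.gd s r \<inter> S \<subseteq> q ` ?B"
    proof
      fix u assume u: "u \<in> ball_on V X.gd s r \<inter> S"
      then obtain y where y: "y \<in> Z" "u = q y" "X.gd (q z) (q y) \<le> r" using Z z by (auto simp: ball_on_def)
      have yG: "y \<in> carrier G" using y Z \<Z> by blast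
      have "wd z y \<le> a * (X.gd (q z) (q y) + b)" by (rule low[OF zG yG])
      also have "\<dots> \<le> a * (r + b)" using y(3) a by simp
      finally show "u \<in> q ` ?B" using y yG by (auto simp: ball_on_def algebra_simps)
    qed
    then have "card (ball_on V X.gd s r \<inter> S) \<le> card ?B"
      by (rule surj_card_le[rotated]) (use finite_ball[OF zG] in auto)
    also have "real (card ?B) \<le> v (a * r + a * b)"
      using a b r by (intro vol Z z) auto
    finally show "real (card (ball_on V X.gd s r \<inter> S)) \<le> v (a * r + a * b)" by simp
  qed
  moreover have "\<S> \<subseteq> Pow V" using \<Z> qV by (auto simp: \<S>_def)
  ultimately have nsep: "\<not> coarsely_separates V X.gd \<S>" "\<S> \<subseteq> Pow V" by blast+
  \<comment> \<open>consecutive points in \<open>G\<close> have distance at most \<open>a * (1 + 3 * b)\<close>; this \<open>L\<close> makes their distance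
    to \<open>Z\<close> larger than that\<close>
  define L where "L = a * (a * (1 + 3 * b)) + 2 * b + 1"
  have L0: "L \<ge> 0" using a b by (simp add: L_def)
  obtain D where D0: "0 \<le> D" and D: "\<forall>Z\<in>\<S>. \<forall>C1 \<in> coarse_components X.gd 1 (V - nbhd V X.gd Z L).
      \<forall>C2 \<in> coarse_components X.gd 1 (V - nbhd V X.gd Z L).
      \<forall>x\<in>C1. \<forall>y\<in>C2. ennreal D \<le> dist_to X.gd x Z \<longrightarrow> ennreal D \<le> dist_to X.gd y Z \<longrightarrow> C1 = C2"
    using not_coarsely_separatesD[OF nsep X.graph_coarsely_connected zero_le_one L0] by (elim exE conjE)
  define D1 where "D1 = max D (L + 1)"
  define D' where "D' = a * (D1 + b)"
  have "D1 \<ge> 0" using D0 by (simp add: D1_def)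
  then have D': "D' \<ge> 0" using a b by (simp add: D'_def)
  have main: "(x, y) \<in> (edges_avoiding Z)\<^sup>*"
    if Z: "Z \<in> \<Z>" and x: "x \<in> carrier G" and y: "y \<in> carrier G"
      and xfar: "\<forall>z\<in>Z. D' \<le> wd x z" and yfar: "\<forall>z\<in>Z. D' \<le> wd y z" for Z x y
  proof -
    let ?Y = "V - nbhd V X.gd (q ` Z) L"
    have ZG: "Z \<subseteq> carrier G" using \<Z> Z by blast
    have far: "ennreal D1 \<le> dist_to X.gd (q g) (q ` Z)" if "g \<in> carrier G" "\<forall>z\<in>Z. D' \<le> wd g z" for g
      unfolding dist_to_ge_iff
    proof (clarify, rule ennreal_leI)
      fix z assume z: "z \<in> Z"
      have "a * (D1 + b) \<le> a * (X.gd (q g) (q z) + b)"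
        using low[OF that(1) subsetD[OF ZG z]] bspec[OF that(2) z] unfolding D'_def by linarith
      then show "D1 \<le> X.gd (q g) (q z)" using a by simp
    qed
    have inY: "q g \<in> ?Y" "ennreal D \<le> dist_to X.gd (q g) (q ` Z)"
      if "g \<in> carrier G" "\<forall>z\<in>Z. D' \<le> wd g z" for g
    proof -
      have "ennreal L < ennreal D1" using L0 by (intro ennreal_lessI) (auto simp: D1_def)
      then have "q g \<notin> nbhd V X.gd (q ` Z) L" using far[OF that] unfolding nbhd_def by (auto simp: not_le)
      then show "q g \<in> ?Y" using qV that by blast
      have "ennreal D \<le> ennreal D1" by (intro ennreal_leI) (simp add: D1_def)
      then show "ennreal D \<le> dist_to X.gd (q g) (q ` Z)" using far[OF that] by (rule order_trans)
    qed
    have symY: "X.gd u w = X.gd w u" if "u \<in> ?Y" "w \<in> ?Y" for u w using that X.gd_sym by blast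
    obtain C1 where C1: "C1 \<in> coarse_components X.gd 1 ?Y" "q x \<in> C1"
      using ex_coarse_component[where d="X.gd" and Y="?Y" and k=1, OF symY inY(1)[OF x xfar]] by blast
    obtain C2 where C2: "C2 \<in> coarse_components X.gd 1 ?Y" "q y \<in> C2"
      using ex_coarse_component[where d="X.gd" and Y="?Y" and k=1, OF symY inY(1)[OF y yfar]] by blast
    have "q ` Z \<in> \<S>" using Z by (auto simp: \<S>_def)
    then have "C1 = C2"
      using D[rule_format, OF _ C1(1) C2(1) C1(2) C2(2) inY(2)[OF x xfar] inY(2)[OF y yfar]] by simp
    then have "coarsely_connected X.gd 1 C1" "q y \<in> C1" "C1 \<subseteq> ?Y"
      using C1 C2 by (auto simp: coarse_components_def)
    note C = this
    obtain p where p: "p \<noteq> []" "hd p = q x" "last p = q y" "set p \<subseteq> C1"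
      "successively (\<lambda>u v. X.gd u v \<le> 1) p"
      using C(1)[unfolded coarsely_connected_def, rule_format, OF C1(2) C(2)] by (elim exE conjE)
    have pY: "set p \<subseteq> ?Y" using p(4) C(3) by (rule subset_trans)
    have farY: "L \<le> X.gd u (q z)" if "u \<in> ?Y" "z \<in> Z" for u z
    proof (rule ccontr)
      assume "\<not> L \<le> X.gd u (q z)"
      then have "u \<in> nbhd V X.gd (q ` Z) L" using that by (intro nbhdI) auto
      with that(1) show False by blast
    qed
    have step: "(g, h) \<in> (edges_avoiding Z)\<^sup>*"
      if g: "g \<in> carrier G" and h: "h \<in> carrier G" and u: "u \<in> ?Y" and w: "w \<in> ?Y"
        and gu: "X.gd (q g) u \<le> b" and hw: "X.gd (q h) w \<le> b" and uw: "X.gd u w \<le> 1" for g h u w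
    proof (rule short_path_avoiding[OF g h ZG], intro ballI)
      fix z assume z: "z \<in> Z"
      have "X.gd (q g) (q h) \<le> X.gd (q g) u + X.gd u (q h)"
        using qV g h u by (intro X.gd_triangle) auto
      also have "X.gd u (q h) \<le> X.gd u w + X.gd w (q h)"
        using qV h u w by (intro X.gd_triangle) auto
      also have "X.gd w (q h) = X.gd (q h) w" using qV h w by (intro X.gd_sym) auto
      finally have "X.gd (q g) (q h) + b \<le> 1 + 3 * b" using gu hw uw by linarith
      then have "a * (X.gd (q g) (q h) + b) \<le> a * (1 + 3 * b)" using a by (intro mult_left_mono) auto
      then have 1: "wd g h \<le> a * (1 + 3 * b)" using low[OF g h] by linarith
      have zG: "z \<in> carrier G" using z ZG by blast
      have "L \<le> X.gd u (q z)" by (rule farY[OF u z])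
      also have "\<dots> \<le> X.gd u (q g) + X.gd (q g) (q z)" using qV u g zG by (intro X.gd_triangle) auto
      also have "X.gd u (q g) = X.gd (q g) u" using qV g u by (intro X.gd_sym) auto
      finally have "L - b \<le> a * wd g z + b" using gu up[OF g zG] by linarith
      then have "a * (a * (1 + 3 * b)) < a * wd g z" unfolding L_def by linarith
      then show "wd g h < wd g z" using 1 a by simp
    qed
    have "(g, h) \<in> (edges_avoiding Z)\<^sup>*"
      if "p \<noteq> []" "set p \<subseteq> ?Y" "successively (\<lambda>u v. X.gd u v \<le> 1) p"
        "g \<in> carrier G" "h \<in> carrier G" "X.gd (q g) (hd p) \<le> b" "X.gd (q h) (last p) \<le> b" for g h p
      using that
    proof (induction p arbitrary: g)
      case (Cons u p)
      show ?case
      proof (cases p)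
        case Nil
        with Cons.prems show ?thesis by (intro step[of g h u u]) auto
      next
        case (Cons w p')
        then have w: "w \<in> ?Y" using Cons.prems(2) by auto
        then obtain k where k: "k \<in> carrier G" "X.gd (q k) w \<le> b" using dense by blast
        have "(g, k) \<in> (edges_avoiding Z)\<^sup>*"
          using Cons.prems \<open>p = w # p'\<close> k w by (intro step[of g k u w]) auto
        moreover have "(k, h) \<in> (edges_avoiding Z)\<^sup>*"
          using Cons.prems \<open>p = w # p'\<close> k by (intro Cons.IH) auto
        ultimately show ?thesis by (rule rtrancl_trans)
      qed
    qed simp
    from this[OF p(1) pY p(5) x y] p(2,3) b show ?thesis by simp
  qed
  show ?thesis
    by (intro exI[of _ D'] conjI ballI impI D') (rule main)
qed

end

section \<open>Separation by a single component\<close>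

primrec path_vertices :: "('a, 'c) monoid_scheme \<Rightarrow> 'a \<Rightarrow> 'a list \<Rightarrow> 'a set" where
  "path_vertices G g [] = {g}"
| "path_vertices G g (s # w) = insert g (path_vertices G (g \<otimes>\<^bsub>G\<^esub> s) w)"

context marked_group
begin

lemma path_vertices_start: "g \<in> path_vertices G g w"
  by (cases w) auto

lemma finite_path_vertices: "finite (path_vertices G g w)"
  by (induction w arbitrary: g) auto

lemma path_vertices_closed: "g \<in> carrier G \<Longrightarrow> set w \<subseteq> letters \<Longrightarrow> path_vertices G g w \<subseteq> carrier G"
proof (induction w arbitrary: g)
  case (Cons s w)
  then have "g \<otimes> s \<in> carrier G" using letters_closed by auto
  from Cons.IH[OF this] Cons.prems show ?case by auto
qed simp

lemma path_vertices_dist_start: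
  "g \<in> carrier G \<Longrightarrow> set w \<subseteq> letters \<Longrightarrow> u \<in> path_vertices G g w \<Longrightarrow> wd g u \<le> length w"
proof (induction w arbitrary: g)
  case (Cons s w)
  have s: "s \<in> letters" "g \<otimes> s \<in> carrier G" and w: "set w \<subseteq> letters" using Cons.prems letters_closed by auto
  show ?case
  proof (cases "u = g")
    case False
    then have u: "u \<in> path_vertices G (g \<otimes> s) w" using Cons.prems by simp
    have "wd g u \<le> wd g (g \<otimes> s) + wd (g \<otimes> s) u"
      using Cons.prems(1) s u path_vertices_closed[OF s(2) w] by (intro wd_triangle) auto
    also have "\<dots> \<le> 1 + length w"
      using wd_letter[OF Cons.prems(1) s(1)] Cons.IH[OF s(2) w u] by simp
    finally show ?thesis by simp
  qed (use Cons.prems in simp)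
qed simp

lemma path_vertices_dist:
  "g \<in> carrier G \<Longrightarrow> set w \<subseteq> letters \<Longrightarrow> u \<in> path_vertices G g w \<Longrightarrow> v \<in> path_vertices G g w \<Longrightarrow>
    wd u v \<le> length w"
proof (induction w arbitrary: g)
  case (Cons s w)
  have gs: "g \<otimes> s \<in> carrier G" and w: "set w \<subseteq> letters" using Cons.prems letters_closed by auto
  note c = path_vertices_closed[OF Cons.prems(1,2)]
  consider "u = g" | "v = g" | "u \<in> path_vertices G (g \<otimes> s) w" "v \<in> path_vertices G (g \<otimes> s) w"
    using Cons.prems by auto
  then show ?case
  proof cases
    case 1 then show ?thesis using path_vertices_dist_start Cons.prems by blast
  next
    case 2 then show ?thesis
      using path_vertices_dist_start[OF Cons.prems(1-3)] wd_sym[of u v] Cons.prems c by auto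
  next
    case 3 from Cons.IH[OF gs w this] show ?thesis by simp
  qed
qed simp

text \<open>The steps of \<open>h\<close>-paths in \<open>Y\<close>; the components of \<open>Y\<close> at scale \<open>h\<close> are the classes of the equivalence
  relation that they generate.\<close>

definition hops :: "real \<Rightarrow> 'a set \<Rightarrow> ('a \<times> 'a) set" where
  "hops h Y = {(u, v). u \<in> Y \<and> v \<in> Y \<and> wd u v \<le> h}"

definition component_of :: "real \<Rightarrow> 'a set \<Rightarrow> 'a \<Rightarrow> 'a set" where
  "component_of h Y z = (hops h Y)\<^sup>* `` {z}"

lemma component_of_subset: "z \<in> Y \<Longrightarrow> component_of h Y z \<subseteq> Y"
  unfolding component_of_def by (auto simp: hops_def elim: rtranclE)

lemma component_of_step:
  "u \<in> component_of h Y z \<Longrightarrow> u \<in> Y \<Longrightarrow> v \<in> Y \<Longrightarrow> wd u v \<le> h \<Longrightarrow> v \<in> component_of h Y z"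
  unfolding component_of_def by (auto simp: hops_def intro: rtrancl_into_rtrancl)

lemma component_of_eq:
  assumes "Y \<subseteq> carrier G" "u \<in> component_of h Y z" shows "component_of h Y z = component_of h Y u"
proof -
  have "sym (hops h Y)" using wd_sym assms(1) by (auto simp: sym_def hops_def subset_iff)
  then have s: "sym ((hops h Y)\<^sup>*)" by (rule sym_rtrancl)
  have zu: "(z, u) \<in> (hops h Y)\<^sup>*" using assms(2) by (simp add: component_of_def)
  with symD[OF s zu] show ?thesis
    unfolding component_of_def by (auto intro: rtrancl_trans)
qed

text \<open>The part on \<open>Z\<close> of the coboundary of \<open>f\<close>.\<close>

definition increment :: "('a \<Rightarrow> int) \<Rightarrow> 'a set \<Rightarrow> 'a \<Rightarrow> 'a \<Rightarrow> int" where
  "increment f Z u v = (if u \<in> Z \<and> v \<in> Z then f v - f u else 0)"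

lemma path_sum_increment_disjoint:
  "path_vertices G g w \<inter> Z = {} \<Longrightarrow> path_sum G (increment f Z) g w = 0"
  by (induction w arbitrary: g) (auto simp: increment_def)

text \<open>If a path meets \<open>Y\<close> only inside \<open>Z\<close>, then \<open>f\<close> changes only along edges in \<open>Z\<close>, and the sum telescopes.\<close>

lemma path_sum_increment_filled:
  assumes edge: "\<And>x s. x \<in> carrier G \<Longrightarrow> s \<in> letters \<Longrightarrow> f x \<noteq> f (x \<otimes> s) \<Longrightarrow> x \<in> Y \<and> x \<otimes> s \<in> Y"
  shows "g \<in> carrier G \<Longrightarrow> set w \<subseteq> letters \<Longrightarrow> path_vertices G g w \<inter> Y \<subseteq> Z \<Longrightarrow>
    path_sum G (increment f Z) g w = f (g \<otimes> word_prod w) - f g"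
proof (induction w arbitrary: g)
  case (Cons s w)
  have s: "s \<in> letters" "s \<in> carrier G" and w: "set w \<subseteq> letters" "word_prod w \<in> carrier G"
    using Cons.prems letters_closed letters_carrier[of w] by auto
  have "increment f Z g (g \<otimes> s) = f (g \<otimes> s) - f g"
    using edge[OF Cons.prems(1) s(1)] Cons.prems(3) path_vertices_start[of "g \<otimes> s" w]
    by (auto simp: increment_def)
  moreover have "path_sum G (increment f Z) (g \<otimes> s) w = f (g \<otimes> s \<otimes> word_prod w) - f (g \<otimes> s)"
    using Cons.prems s w by (intro Cons.IH) auto
  ultimately show ?case using Cons.prems(1) s w by (simp add: m_assoc)
qed simp

lemma path_sum_avoiding:
  assumes "(x, y) \<in> (edges_avoiding Z)\<^sup>*" "x \<in> carrier G"
  shows "\<exists>w. set w \<subseteq> letters \<and> x \<otimes> word_prod w = y \<and> path_sum G (increment f Z) x w = 0"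
  using assms
proof (induction rule: converse_rtrancl_induct)
  case base then show ?case by (intro exI[of _ "[]"]) simp
next
  case (step u v)
  then obtain s where s: "s \<in> letters" "v = u \<otimes> s" "u \<notin> Z" by (auto simp: edges_avoiding_def)
  have c: "s \<in> carrier G" "v \<in> carrier G" using s step.prems letters_closed by auto
  then obtain w where w: "set w \<subseteq> letters" "v \<otimes> word_prod w = y" "path_sum G (increment f Z) v w = 0"
    using step.IH by blast
  show ?case
  proof (intro exI[of _ "s # w"] conjI)
    show "u \<otimes> word_prod (s # w) = y"
      using w s c step.prems letters_carrier[of w] by (simp add: m_assoc[symmetric])
    show "path_sum G (increment f Z) u (s # w) = 0" using w(3) s by (simp add: increment_def)
  qed (use s w in auto)
qed

text \<open>A loop of length at most \<open>l \<le> h\<close> that meets the component cannot meet \<open>Y\<close> elsewhere, so along it the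
  increment is the full coboundary of \<open>f\<close>, and it is 0 along all other short loops.  Hence the
  integral over short loops vanishes, and so does the integral over all loops.\<close>

lemma component_increment_exact:
  assumes loops: "short_loops_suffice G S l" and Y: "Y \<subseteq> carrier G"
    and edge: "\<And>x s. x \<in> carrier G \<Longrightarrow> s \<in> letters \<Longrightarrow> f x \<noteq> f (x \<otimes> s) \<Longrightarrow> x \<in> Y \<and> x \<otimes> s \<in> Y"
    and h: "real l \<le> h" and z: "z \<in> Y"
    and g: "g \<in> carrier G" and w: "set w \<subseteq> letters" "word_prod w = \<one>"
  shows "path_sum G (increment f (component_of h Y z)) g w = 0"
proof -
  let ?Z = "component_of h Y z"
  have short: "path_sum G (increment f ?Z) g w = 0"
    if g: "g \<in> carrier G" and w: "set w \<subseteq> letters" "length w \<le> l" "word_prod w = \<one>" for g w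
  proof (cases "path_vertices G g w \<inter> ?Z = {}")
    case True then show ?thesis by (rule path_sum_increment_disjoint)
  next
    case False
    then obtain u where u: "u \<in> path_vertices G g w" "u \<in> ?Z" by blast
    have "path_vertices G g w \<inter> Y \<subseteq> ?Z"
    proof
      fix v assume v: "v \<in> path_vertices G g w \<inter> Y"
      then have "wd u v \<le> length w" using path_vertices_dist[OF g w(1) u(1)] by blast
      then have "wd u v \<le> h" using w(2) h by linarith
      with v u component_of_subset[OF z] show "v \<in> ?Z" by (intro component_of_step[OF u(2)]) auto
    qed
    from path_sum_increment_filled[OF edge g w(1) this] show ?thesis using w(3) g by simp
  qed
  have "\<forall>x\<in>carrier G. \<forall>y\<in>carrier G. increment f ?Z y x = - increment f ?Z x y"
    by (auto simp: increment_def)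
  with loops short g w show ?thesis unfolding short_loops_suffice_def by blast
qed

text \<open>An edge along which \<open>f\<close> changes has both ends in \<open>Y\<close> and therefore, as \<open>h \<ge> 1\<close>, in the same component:
  the coboundary of \<open>f\<close> is the sum of its parts on the components.  A path meets only finitely many of
  these, so a finite set \<open>I\<close> of components suffices.\<close>

lemma sum_increments_components:
  assumes Y: "Y \<subseteq> carrier G" and I: "finite I" "I \<subseteq> component_of h Y ` Y" and h: "1 \<le> h"
    and edge: "\<And>x s. x \<in> carrier G \<Longrightarrow> s \<in> letters \<Longrightarrow> f x \<noteq> f (x \<otimes> s) \<Longrightarrow> x \<in> Y \<and> x \<otimes> s \<in> Y"
  shows "g \<in> carrier G \<Longrightarrow> set w \<subseteq> letters \<Longrightarrow> component_of h Y ` (path_vertices G g w \<inter> Y) \<subseteq> I \<Longrightarrow>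
    (\<Sum>Z\<in>I. path_sum G (increment f Z) g w) = f (g \<otimes> word_prod w) - f g"
proof (induction w arbitrary: g)
  case (Cons s w)
  have s: "s \<in> letters" "s \<in> carrier G" and w: "set w \<subseteq> letters" "word_prod w \<in> carrier G"
    using Cons.prems letters_closed letters_carrier[of w] by auto
  have "(\<Sum>Z\<in>I. increment f Z g (g \<otimes> s)) = f (g \<otimes> s) - f g"
  proof (cases "g \<in> Y \<and> g \<otimes> s \<in> Y")
    case True
    let ?Z = "component_of h Y g"
    have Z: "?Z \<in> I" using Cons.prems(3) True by auto
    have gZ: "g \<in> ?Z" by (simp add: component_of_def)
    have "wd g (g \<otimes> s) \<le> h" using wd_letter[OF Cons.prems(1) s(1)] h by simp
    with True gZ have sZ: "g \<otimes> s \<in> ?Z" by (intro component_of_step[OF gZ]) auto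
    have "increment f Z g (g \<otimes> s) = 0" if "Z \<in> I - {?Z}" for Z
    proof -
      have "g \<notin> Z" using that I(2) component_of_eq[OF Y, of g] by auto
      then show ?thesis by (simp add: increment_def)
    qed
    then have "(\<Sum>Z\<in>I. increment f Z g (g \<otimes> s)) = increment f ?Z g (g \<otimes> s)"
      using sum.remove[OF I(1) Z, of "\<lambda>Z. increment f Z g (g \<otimes> s)"] by simp
    with gZ sZ show ?thesis by (simp add: increment_def)
  next
    case False
    have "Z \<subseteq> Y" if "Z \<in> I" for Z using that I(2) component_of_subset by blast
    then have "increment f Z g (g \<otimes> s) = 0" if "Z \<in> I" for Z
      using that False by (auto simp: increment_def)
    moreover have "f g = f (g \<otimes> s)" using edge[OF Cons.prems(1) s(1)] False by blast
    ultimately show ?thesis by simp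
  qed
  moreover have "(\<Sum>Z\<in>I. path_sum G (increment f Z) (g \<otimes> s) w) = f (g \<otimes> s \<otimes> word_prod w) - f (g \<otimes> s)"
    using Cons.prems s w by (intro Cons.IH) auto
  ultimately show ?case using Cons.prems(1) s w by (simp add: m_assoc sum.distrib)
qed simp

text \<open>A coarse form of the unicoherence of simply connected spaces: if a set separates two points, then so
  does one of its components.  The difference \<open>f y - f x\<close> is the sum, over the components \<open>Z\<close>, of the
  integral of the increment on \<open>Z\<close> along a path from \<open>x\<close> to \<open>y\<close>.  This integral does not depend on the
  path, and it vanishes along a path that avoids \<open>Z\<close>.\<close>

theorem constant_unless_component_separates:
  fixes f :: "'a \<Rightarrow> int"
  assumes loops: "short_loops_suffice G S l" and Y: "Y \<subseteq> carrier G"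
    and edge: "\<And>x s. x \<in> carrier G \<Longrightarrow> s \<in> letters \<Longrightarrow> f x \<noteq> f (x \<otimes> s) \<Longrightarrow> x \<in> Y \<and> x \<otimes> s \<in> Y"
    and h: "real l \<le> h" "1 \<le> h"
    and xy: "x \<in> carrier G" "y \<in> carrier G"
    and conn: "\<And>z. z \<in> Y \<Longrightarrow> (y, x) \<in> (edges_avoiding (component_of h Y z))\<^sup>*"
  shows "f x = f y"
proof -
  obtain w where w: "set w \<subseteq> letters" "x \<otimes> word_prod w = y" using geodesic[OF xy] by blast
  define I where "I = component_of h Y ` (path_vertices G x w \<inter> Y)"
  have I: "finite I" "I \<subseteq> component_of h Y ` Y"
    unfolding I_def using finite_path_vertices by auto
  have "path_sum G (increment f Z) x w = 0" if Z: "Z \<in> I" for Z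
  proof -
    obtain z where z: "z \<in> Y" "Z = component_of h Y z" using Z I by blast
    obtain u where u: "set u \<subseteq> letters" "y \<otimes> word_prod u = x" "path_sum G (increment f Z) y u = 0"
      using path_sum_avoiding[OF conn[OF z(1)] xy(2)] unfolding z(2) by blast
    have c: "set w \<subseteq> carrier G" "set u \<subseteq> carrier G" using w u letters_carrier by auto
    have "x \<otimes> word_prod (w @ u) = x"
      using w(2) u(2) xy c word_prod_append[OF c] by (simp add: m_assoc[symmetric] del: foldr_append)
    then have one: "word_prod (w @ u) = \<one>"
      using xy c word_prod_closed[of "w @ u"] by (simp del: foldr_append)
    have "path_sum G (increment f Z) x (w @ u) = 0"
      unfolding z(2)
      by (rule component_increment_exact[OF loops Y edge h(1) z(1) xy(1) _ one]) (use w u in auto)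
    then show ?thesis
      using path_sum_append[OF xy(1) c, of "increment f Z"] w(2) u(3) by simp
  qed
  then have "(\<Sum>Z\<in>I. path_sum G (increment f Z) x w) = 0" by simp
  moreover have "(\<Sum>Z\<in>I. path_sum G (increment f Z) x w) = f (x \<otimes> word_prod w) - f x"
    by (rule sum_increments_components[OF Y I h(2) edge xy(1) w(1)]) (simp_all add: I_def)
  ultimately show ?thesis using w(2) by simp
qed

end

section \<open>Distances in wreath products\<close>

locale wreath = A: group A + B: group B
  for A :: "('a, 'c) monoid_scheme" and B :: "('b, 'd) monoid_scheme"
begin

abbreviation W :: "(('b \<Rightarrow> 'a) \<times> 'b) monoid" where "W \<equiv> wreath_product A B"

lemma mem_W_iff:
  "u \<in> carrier W \<longleftrightarrow> fst u \<in> (\<Pi>\<^sub>E b\<in>carrier B. carrier A) \<and>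
     finite {b \<in> carrier B. fst u b \<noteq> \<one>\<^bsub>A\<^esub>} \<and> snd u \<in> carrier B"
proof -
  have "carrier (sum_group (carrier B) (\<lambda>_. A)) =
      {c \<in> \<Pi>\<^sub>E b\<in>carrier B. carrier A. finite {b \<in> carrier B. c b \<noteq> \<one>\<^bsub>A\<^esub>}}"
    by (rule carrier_sum_group) (rule A.is_group)
  then show ?thesis
    by (cases u) (auto simp: wreath_product_def semidirect_product_def)
qed

lemma W_lamp: "u \<in> carrier W \<Longrightarrow> b \<in> carrier B \<Longrightarrow> fst u b \<in> carrier A"
  by (auto simp: mem_W_iff)

lemma W_pos: "u \<in> carrier W \<Longrightarrow> snd u \<in> carrier B"
  by (auto simp: mem_W_iff)

lemma W_eqI:
  assumes "u \<in> carrier W" "v \<in> carrier W" "snd u = snd v" "\<And>b. b \<in> carrier B \<Longrightarrow> fst u b = fst v b"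
  shows "u = v"
proof (rule prod_eqI)
  show "fst u = fst v"
    by (rule PiE_ext[where k = "carrier B" and s = "\<lambda>_. carrier A"]) (use assms in \<open>auto simp: mem_W_iff\<close>)
qed fact

lemma W_mult:
  "u \<otimes>\<^bsub>W\<^esub> v = (\<lambda>b\<in>carrier B. fst u b \<otimes>\<^bsub>A\<^esub> (\<lambda>x\<in>carrier B. fst v (inv\<^bsub>B\<^esub> (snd u) \<otimes>\<^bsub>B\<^esub> x)) b, snd u \<otimes>\<^bsub>B\<^esub> snd v)"
  by (simp add: wreath_product_def semidirect_product_def shift_def case_prod_beta)

lemma W_mult_lamp:
  "b \<in> carrier B \<Longrightarrow> fst (u \<otimes>\<^bsub>W\<^esub> v) b = fst u b \<otimes>\<^bsub>A\<^esub> fst v (inv\<^bsub>B\<^esub> (snd u) \<otimes>\<^bsub>B\<^esub> b)"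
  by (simp add: W_mult)

lemma W_mult_pos: "snd (u \<otimes>\<^bsub>W\<^esub> v) = snd u \<otimes>\<^bsub>B\<^esub> snd v"
  by (simp add: W_mult)

lemma W_one: "\<one>\<^bsub>W\<^esub> = (\<lambda>b\<in>carrier B. \<one>\<^bsub>A\<^esub>, \<one>\<^bsub>B\<^esub>)"
  by (simp add: wreath_product_def semidirect_product_def)

lemma finite_translate:
  assumes "p \<in> carrier B" "finite {b \<in> carrier B. P b}"
  shows "finite {b \<in> carrier B. P (inv\<^bsub>B\<^esub> p \<otimes>\<^bsub>B\<^esub> b)}"
proof (rule finite_subset)
  show "{b \<in> carrier B. P (inv\<^bsub>B\<^esub> p \<otimes>\<^bsub>B\<^esub> b)} \<subseteq> (\<otimes>\<^bsub>B\<^esub>) p ` {b \<in> carrier B. P b}"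
  proof
    fix b assume "b \<in> {b \<in> carrier B. P (inv\<^bsub>B\<^esub> p \<otimes>\<^bsub>B\<^esub> b)}"
    with assms(1) show "b \<in> (\<otimes>\<^bsub>B\<^esub>) p ` {b \<in> carrier B. P b}"
      by (intro image_eqI[of _ _ "inv\<^bsub>B\<^esub> p \<otimes>\<^bsub>B\<^esub> b"]) (auto simp: B.m_assoc[symmetric])
  qed
qed (use assms in simp)

lemma group_W: "group W"
proof (rule groupI)
  fix u v assume u: "u \<in> carrier W" and v: "v \<in> carrier W"
  have "{b \<in> carrier B. fst (u \<otimes>\<^bsub>W\<^esub> v) b \<noteq> \<one>\<^bsub>A\<^esub>} \<subseteq>
      {b \<in> carrier B. fst u b \<noteq> \<one>\<^bsub>A\<^esub>} \<union> {b \<in> carrier B. fst v (inv\<^bsub>B\<^esub> (snd u) \<otimes>\<^bsub>B\<^esub> b) \<noteq> \<one>\<^bsub>A\<^esub>}"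
    by (auto simp: W_mult_lamp)
  moreover have "finite ({b \<in> carrier B. fst u b \<noteq> \<one>\<^bsub>A\<^esub>} \<union>
      {b \<in> carrier B. fst v (inv\<^bsub>B\<^esub> (snd u) \<otimes>\<^bsub>B\<^esub> b) \<noteq> \<one>\<^bsub>A\<^esub>})"
    using u v finite_translate[of "snd u" "\<lambda>b. fst v b \<noteq> \<one>\<^bsub>A\<^esub>"] by (simp add: mem_W_iff)
  ultimately have "finite {b \<in> carrier B. fst (u \<otimes>\<^bsub>W\<^esub> v) b \<noteq> \<one>\<^bsub>A\<^esub>}" by (rule finite_subset)
  moreover have "fst (u \<otimes>\<^bsub>W\<^esub> v) \<in> (\<Pi>\<^sub>E b\<in>carrier B. carrier A)"
    unfolding W_mult using u v by (auto simp: mem_W_iff intro!: A.m_closed)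
  ultimately show "u \<otimes>\<^bsub>W\<^esub> v \<in> carrier W"
    using u v unfolding mem_W_iff[of "u \<otimes>\<^bsub>W\<^esub> v"] by (auto simp: W_mult_pos W_pos)
next
  show "\<one>\<^bsub>W\<^esub> \<in> carrier W" unfolding mem_W_iff W_one by auto
next
  fix u v w assume u: "u \<in> carrier W" and v: "v \<in> carrier W" and w: "w \<in> carrier W"
  note [simp] = u v w W_pos
  show "u \<otimes>\<^bsub>W\<^esub> v \<otimes>\<^bsub>W\<^esub> w = u \<otimes>\<^bsub>W\<^esub> (v \<otimes>\<^bsub>W\<^esub> w)"
  proof (rule prod_eqI)
    show "fst (u \<otimes>\<^bsub>W\<^esub> v \<otimes>\<^bsub>W\<^esub> w) = fst (u \<otimes>\<^bsub>W\<^esub> (v \<otimes>\<^bsub>W\<^esub> w))"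
    proof (rule extensionalityI[of _ "carrier B"])
      fix b assume b: "b \<in> carrier B"
      then have *: "inv\<^bsub>B\<^esub> (snd u) \<otimes>\<^bsub>B\<^esub> b \<in> carrier B" by simp
      have "inv\<^bsub>B\<^esub> (snd u \<otimes>\<^bsub>B\<^esub> snd v) \<otimes>\<^bsub>B\<^esub> b = inv\<^bsub>B\<^esub> (snd v) \<otimes>\<^bsub>B\<^esub> (inv\<^bsub>B\<^esub> (snd u) \<otimes>\<^bsub>B\<^esub> b)"
        using b by (simp add: B.inv_mult_group B.m_assoc)
      then show "fst (u \<otimes>\<^bsub>W\<^esub> v \<otimes>\<^bsub>W\<^esub> w) b = fst (u \<otimes>\<^bsub>W\<^esub> (v \<otimes>\<^bsub>W\<^esub> w)) b"
        using b * by (simp add: W_mult_lamp W_mult_pos A.m_assoc W_lamp)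
    qed (simp_all add: W_mult)
    show "snd (u \<otimes>\<^bsub>W\<^esub> v \<otimes>\<^bsub>W\<^esub> w) = snd (u \<otimes>\<^bsub>W\<^esub> (v \<otimes>\<^bsub>W\<^esub> w))"
      by (simp add: W_mult_pos B.m_assoc)
  qed
next
  fix u assume u: "u \<in> carrier W"
  note [simp] = u W_pos
  show "\<one>\<^bsub>W\<^esub> \<otimes>\<^bsub>W\<^esub> u = u"
  proof (rule prod_eqI)
    show "fst (\<one>\<^bsub>W\<^esub> \<otimes>\<^bsub>W\<^esub> u) = fst u"
    proof (rule extensionalityI[of _ "carrier B"])
      fix b assume "b \<in> carrier B"
      then show "fst (\<one>\<^bsub>W\<^esub> \<otimes>\<^bsub>W\<^esub> u) b = fst u b" by (simp add: W_mult_lamp W_one W_lamp)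
    next
      show "fst u \<in> extensional (carrier B)" using u by (auto simp: mem_W_iff PiE_def)
    qed (simp add: W_mult)
  qed (simp add: W_mult_pos W_one)
  define y where "y = (\<lambda>x\<in>carrier B. inv\<^bsub>A\<^esub> (fst u (snd u \<otimes>\<^bsub>B\<^esub> x)), inv\<^bsub>B\<^esub> (snd u))"
  have sup: "{b \<in> carrier B. fst y b \<noteq> \<one>\<^bsub>A\<^esub>} \<subseteq> {b \<in> carrier B. fst u (snd u \<otimes>\<^bsub>B\<^esub> b) \<noteq> \<one>\<^bsub>A\<^esub>}"
    by (auto simp: y_def)
  have "finite {b \<in> carrier B. fst u b \<noteq> \<one>\<^bsub>A\<^esub>}" using u by (auto simp: mem_W_iff)
  from finite_subset[OF sup] finite_translate[OF _ this, of "inv\<^bsub>B\<^esub> (snd u)"]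
  have "finite {b \<in> carrier B. fst y b \<noteq> \<one>\<^bsub>A\<^esub>}" by simp
  then have y: "y \<in> carrier W"
    unfolding mem_W_iff using W_lamp[OF u] by (auto simp: y_def)
  moreover have "y \<otimes>\<^bsub>W\<^esub> u = \<one>\<^bsub>W\<^esub>"
  proof (rule prod_eqI)
    show "fst (y \<otimes>\<^bsub>W\<^esub> u) = fst \<one>\<^bsub>W\<^esub>"
    proof (rule extensionalityI[of _ "carrier B"])
      fix b assume "b \<in> carrier B"
      then show "fst (y \<otimes>\<^bsub>W\<^esub> u) b = fst \<one>\<^bsub>W\<^esub> b"
        using W_lamp[OF u, of "snd u \<otimes>\<^bsub>B\<^esub> b"] by (simp add: W_mult_lamp W_one y_def)
    qed (simp_all add: W_mult W_one)
  qed (simp add: W_mult_pos W_one y_def)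
  ultimately show "\<exists>y\<in>carrier W. y \<otimes>\<^bsub>W\<^esub> u = \<one>\<^bsub>W\<^esub>" by blast
qed

end

locale marked_wreath = A: marked_group A SA + B: marked_group B SB + W: marked_group "wreath_product A B" T
  for A :: "('a, 'c) monoid_scheme" and B :: "('b, 'd) monoid_scheme" and SA SB T
begin

sublocale wreath A B ..

abbreviation "dA \<equiv> word_dist A SA"
abbreviation "dB \<equiv> word_dist B SB"
abbreviation "dW \<equiv> word_dist W T"

lemma letter_bound:
  assumes t: "t \<in> carrier W"
  shows "\<exists>k. dB \<one>\<^bsub>B\<^esub> (snd t) \<le> k \<and>
    (\<forall>b\<in>carrier B. (fst t b \<noteq> \<one>\<^bsub>A\<^esub> \<longrightarrow> dB \<one>\<^bsub>B\<^esub> b \<le> k) \<and> dA \<one>\<^bsub>A\<^esub> (fst t b) \<le> k)"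
proof -
  let ?supp = "{b \<in> carrier B. fst t b \<noteq> \<one>\<^bsub>A\<^esub>}"
  define F where "F = insert (dB \<one>\<^bsub>B\<^esub> (snd t)) (dB \<one>\<^bsub>B\<^esub> ` ?supp \<union> (\<lambda>b. dA \<one>\<^bsub>A\<^esub> (fst t b)) ` ?supp)"
  have F: "finite F" using t by (auto simp: F_def mem_W_iff)
  have le: "f \<le> Max F" if "f \<in> F" for f using F that by simp
  have pos: "dB \<one>\<^bsub>B\<^esub> (snd t) \<le> Max F" by (rule le) (simp add: F_def)
  then have "0 \<le> Max F" by (rule order_trans[rotated]) simp
  have "dB \<one>\<^bsub>B\<^esub> b \<le> Max F \<and> dA \<one>\<^bsub>A\<^esub> (fst t b) \<le> Max F" if "b \<in> carrier B" "fst t b \<noteq> \<one>\<^bsub>A\<^esub>" for b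
    using that by (intro conjI le) (auto simp: F_def)
  then have "(fst t b \<noteq> \<one>\<^bsub>A\<^esub> \<longrightarrow> dB \<one>\<^bsub>B\<^esub> b \<le> Max F) \<and> dA \<one>\<^bsub>A\<^esub> (fst t b) \<le> Max F" if "b \<in> carrier B" for b
    using that \<open>0 \<le> Max F\<close> by (cases "fst t b = \<one>\<^bsub>A\<^esub>") simp_all
  with pos show ?thesis by (intro exI[of _ "Max F"] conjI ballI) simp_all
qed

lemma letters_bound:
  "\<exists>k>0. \<forall>t\<in>W.letters. dB \<one>\<^bsub>B\<^esub> (snd t) \<le> k \<and>
    (\<forall>b\<in>carrier B. (fst t b \<noteq> \<one>\<^bsub>A\<^esub> \<longrightarrow> dB \<one>\<^bsub>B\<^esub> b \<le> k) \<and> dA \<one>\<^bsub>A\<^esub> (fst t b) \<le> k)"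
proof -
  have "\<forall>t\<in>W.letters. \<exists>k. dB \<one>\<^bsub>B\<^esub> (snd t) \<le> k \<and>
    (\<forall>b\<in>carrier B. (fst t b \<noteq> \<one>\<^bsub>A\<^esub> \<longrightarrow> dB \<one>\<^bsub>B\<^esub> b \<le> k) \<and> dA \<one>\<^bsub>A\<^esub> (fst t b) \<le> k)"
    using letter_bound W.letters_closed by blast
  from bchoice[OF this] obtain k where k: "\<forall>t\<in>W.letters. dB \<one>\<^bsub>B\<^esub> (snd t) \<le> k t \<and>
    (\<forall>b\<in>carrier B. (fst t b \<noteq> \<one>\<^bsub>A\<^esub> \<longrightarrow> dB \<one>\<^bsub>B\<^esub> b \<le> k t) \<and> dA \<one>\<^bsub>A\<^esub> (fst t b) \<le> k t)" ..
  let ?K = "Max (insert 1 (k ` W.letters))"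
  have fin: "finite (insert 1 (k ` W.letters))" using W.finite_letters by simp
  then have K: "k t \<le> ?K" if "t \<in> W.letters" for t using that by (intro Max_ge) auto
  have "?K > 0" using fin by (auto simp: Max_gr_iff)
  moreover have "dB \<one>\<^bsub>B\<^esub> (snd t) \<le> ?K" if "t \<in> W.letters" for t
    using bspec[OF k that] K[OF that] by linarith
  moreover have "fst t b \<noteq> \<one>\<^bsub>A\<^esub> \<longrightarrow> dB \<one>\<^bsub>B\<^esub> b \<le> ?K" "dA \<one>\<^bsub>A\<^esub> (fst t b) \<le> ?K"
    if "t \<in> W.letters" "b \<in> carrier B" for t b
    using bspec[OF conjunct2[OF bspec[OF k that(1)]] that(2)] K[OF that(1)] by linarith+
  ultimately show ?thesis by (intro exI[of _ ?K] conjI ballI)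
qed

text \<open>One letter moves the arrow by a bounded distance and changes only lamps within a bounded distance of
  it, each by a bounded amount.\<close>

lemma wreath_distance_lower:
  "\<exists>\<kappa>>0. \<forall>u\<in>carrier W. \<forall>v\<in>carrier W. dB (snd u) (snd v) \<le> \<kappa> * dW u v \<and>
     (\<forall>b\<in>carrier B. (fst u b \<noteq> fst v b \<longrightarrow> dB (snd u) b \<le> \<kappa> * dW u v) \<and>
        dA (fst u b) (fst v b) \<le> \<kappa> * dW u v)"
proof -
  obtain k where k: "k > 0" and pos: "\<And>t. t \<in> W.letters \<Longrightarrow> dB \<one>\<^bsub>B\<^esub> (snd t) \<le> k"
    and supp: "\<And>t b. t \<in> W.letters \<Longrightarrow> b \<in> carrier B \<Longrightarrow> fst t b \<noteq> \<one>\<^bsub>A\<^esub> \<Longrightarrow> dB \<one>\<^bsub>B\<^esub> b \<le> k"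
    and lamp: "\<And>t b. t \<in> W.letters \<Longrightarrow> b \<in> carrier B \<Longrightarrow> dA \<one>\<^bsub>A\<^esub> (fst t b) \<le> k"
    using letters_bound by blast
  have posE: "dB (snd u) (snd (u \<otimes>\<^bsub>W\<^esub> t)) \<le> k" if "u \<in> carrier W" "t \<in> W.letters" for u t
  proof -
    have "t \<in> carrier W" using that W.letters_closed by blast
    then show ?thesis
      using B.wd_left_invariant[of "snd u" "\<one>\<^bsub>B\<^esub>" "snd t"] that pos[of t] W_pos[of u] W_pos[of t] by (simp add: W_mult_pos)
  qed
  have suppE: "dB (snd u) b \<le> k"
    if "u \<in> carrier W" "t \<in> W.letters" "b \<in> carrier B" "fst u b \<noteq> fst (u \<otimes>\<^bsub>W\<^esub> t) b" for u t b
  proof -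
    let ?b = "inv\<^bsub>B\<^esub> (snd u) \<otimes>\<^bsub>B\<^esub> b"
    have u: "snd u \<in> carrier B" "fst u b \<in> carrier A" using that W_pos W_lamp by auto
    have b: "?b \<in> carrier B" using u that by simp
    have "fst t ?b \<noteq> \<one>\<^bsub>A\<^esub>" using that(4) u by (auto simp: W_mult_lamp[OF that(3)])
    then have "dB \<one>\<^bsub>B\<^esub> ?b \<le> k" using supp that b by blast
    moreover have "snd u \<otimes>\<^bsub>B\<^esub> ?b = b" using u that by (simp add: B.m_assoc[symmetric])
    ultimately show ?thesis using B.wd_left_invariant[of "snd u" "\<one>\<^bsub>B\<^esub>" ?b] u b by simp
  qed
  have lampE: "dA (fst u b) (fst (u \<otimes>\<^bsub>W\<^esub> t) b) \<le> k"
    if "u \<in> carrier W" "t \<in> W.letters" "b \<in> carrier B" for u t b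
  proof -
    let ?b = "inv\<^bsub>B\<^esub> (snd u) \<otimes>\<^bsub>B\<^esub> b"
    have t: "t \<in> carrier W" using that W.letters_closed by blast
    have u: "snd u \<in> carrier B" "fst u b \<in> carrier A" using that W_pos W_lamp by auto
    have b: "?b \<in> carrier B" using u that by simp
    show ?thesis
      using A.wd_left_invariant[of "fst u b" "\<one>\<^bsub>A\<^esub>" "fst t ?b"] u W_lamp[OF t b] lamp[OF that(2) b]
      by (simp add: W_mult_lamp[OF that(3)])
  qed
  have "dB (snd u) (snd v) \<le> k * dW u v" if "u \<in> carrier W" "v \<in> carrier W" for u v
    by (rule W.lipschitz_from_edges[where e = "\<lambda>u v. dB (snd u) (snd v)", OF posE _ _ that])
      (simp_all add: W_pos B.wd_triangle)
  moreover have "dA (fst u b) (fst v b) \<le> k * dW u v"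
    if "u \<in> carrier W" "v \<in> carrier W" "b \<in> carrier B" for u v b
    by (rule W.lipschitz_from_edges[where e = "\<lambda>u v. dA (fst u b) (fst v b)", OF lampE _ _ that(1,2)])
      (simp_all add: W_lamp A.wd_triangle that(3))
  moreover have "dB (snd u) b \<le> k * dW u v"
    if uv: "u \<in> carrier W" "v \<in> carrier W" and b: "b \<in> carrier B" and ne: "fst u b \<noteq> fst v b" for u v b
  proof -
    \<comment> \<open>the distance from the arrow to a changed lamp violates the triangle inequality when the lamp
      changes only in the second part; taking the maximum with the displacement repairs this\<close>
    let ?e = "\<lambda>u v. max (dB (snd u) (snd v)) (if fst u b = fst v b then 0 else dB (snd u) b)"
    have "?e u v \<le> k * dW u v"
    proof (rule W.lipschitz_from_edges[where e = ?e, OF _ _ _ uv])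
      fix x t assume "x \<in> carrier W" "t \<in> W.letters"
      then show "?e x (x \<otimes>\<^bsub>W\<^esub> t) \<le> k" using posE suppE b k by auto
    next
      fix x y z assume xyz: "x \<in> carrier W" "y \<in> carrier W" "z \<in> carrier W"
      have "dB (snd x) (snd z) \<le> dB (snd x) (snd y) + dB (snd y) (snd z)"
        "dB (snd x) b \<le> dB (snd x) (snd y) + dB (snd y) b"
        using xyz b by (auto intro!: B.wd_triangle W_pos)
      moreover have "0 \<le> dB (snd y) b" "0 \<le> dB (snd y) (snd z)" "0 \<le> dB (snd x) (snd y)" by auto
      ultimately show "?e x z \<le> ?e x y + ?e y z" by (auto simp: max_def)
    qed (auto simp: W_pos)
    with ne show ?thesis by simp
  qed
  ultimately show ?thesis using k by (intro exI[of _ k] conjI ballI impI)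
qed

text \<open>Such \<open>u\<close> and \<open>v\<close> differ by an element of a finite set \<open>F\<close> that depends only on \<open>r\<close> and \<open>s\<close>: the
  configurations supported on the ball of radius \<open>r\<close> with values in the ball of radius \<open>s\<close>.\<close>

lemma wreath_distance_upper:
  "\<exists>R\<ge>0. \<forall>u\<in>carrier W. \<forall>v\<in>carrier W. snd u = snd v \<longrightarrow>
     (\<forall>b\<in>carrier B. (fst u b \<noteq> fst v b \<longrightarrow> dB (snd u) b \<le> r) \<and> dA (fst u b) (fst v b) \<le> s) \<longrightarrow>
     dW u v \<le> R"
proof -
  let ?BB = "ball_on (carrier B) dB \<one>\<^bsub>B\<^esub> r" and ?BA = "ball_on (carrier A) dA \<one>\<^bsub>A\<^esub> s"
  define F where "F = (\<lambda>g. (\<lambda>b\<in>carrier B. if b \<in> ?BB then g b else \<one>\<^bsub>A\<^esub>, \<one>\<^bsub>B\<^esub>)) ` (?BB \<rightarrow>\<^sub>E ?BA)"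
  have "finite F" unfolding F_def by (intro finite_imageI finite_PiE A.finite_ball B.finite_ball) auto
  then have fin: "finite (insert 0 (dW \<one>\<^bsub>W\<^esub> ` F))" by simp
  have "dW u v \<le> Max (insert 0 (dW \<one>\<^bsub>W\<^esub> ` F))"
    if u: "u \<in> carrier W" and v: "v \<in> carrier W" and eq: "snd u = snd v"
      and near: "\<And>b. b \<in> carrier B \<Longrightarrow> fst u b \<noteq> fst v b \<Longrightarrow> dB (snd u) b \<le> r"
      and small: "\<And>b. b \<in> carrier B \<Longrightarrow> dA (fst u b) (fst v b) \<le> s" for u v
  proof -
    define g where "g b = inv\<^bsub>A\<^esub> (fst u (snd u \<otimes>\<^bsub>B\<^esub> b)) \<otimes>\<^bsub>A\<^esub> fst v (snd u \<otimes>\<^bsub>B\<^esub> b)" for b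
    define f where "f = (\<lambda>b\<in>carrier B. g b, \<one>\<^bsub>B\<^esub>)"
    have p: "snd u \<in> carrier B" using u by (rule W_pos)
    have g1: "b \<in> ?BB" if "b \<in> carrier B" "g b \<noteq> \<one>\<^bsub>A\<^esub>" for b
    proof -
      have pb: "snd u \<otimes>\<^bsub>B\<^esub> b \<in> carrier B" using p that by simp
      then have "fst u (snd u \<otimes>\<^bsub>B\<^esub> b) \<noteq> fst v (snd u \<otimes>\<^bsub>B\<^esub> b)"
        using that(2) W_lamp[OF u pb] by (auto simp: g_def)
      then have "dB (snd u) (snd u \<otimes>\<^bsub>B\<^esub> b) \<le> r" using near pb by blast
      then show ?thesis
        using B.wd_left_invariant[of "snd u" "\<one>\<^bsub>B\<^esub>" b] p that by (simp add: ball_on_def)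
    qed
    have g2: "g b \<in> ?BA" if "b \<in> carrier B" for b
    proof -
      have pb: "snd u \<otimes>\<^bsub>B\<^esub> b \<in> carrier B" using p that by simp
      note l = W_lamp[OF u pb] W_lamp[OF v pb]
      have "fst u (snd u \<otimes>\<^bsub>B\<^esub> b) \<otimes>\<^bsub>A\<^esub> g b = fst v (snd u \<otimes>\<^bsub>B\<^esub> b)"
        unfolding g_def using l by (simp add: A.m_assoc[symmetric])
      moreover have "g b \<in> carrier A" unfolding g_def using l by simp
      ultimately show ?thesis
        using A.wd_left_invariant[OF l(1) A.one_closed, of "g b"] small[OF pb] l by (simp add: ball_on_def)
    qed
    have "f \<in> F"
      unfolding F_def
    proof (rule image_eqI)
      show "restrict g ?BB \<in> ?BB \<rightarrow>\<^sub>E ?BA" using g2 by (auto simp: ball_on_def)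
      show "f = (\<lambda>b\<in>carrier B. if b \<in> ?BB then restrict g ?BB b else \<one>\<^bsub>A\<^esub>, \<one>\<^bsub>B\<^esub>)"
        using g1 by (auto simp: f_def fun_eq_iff)
    qed
    moreover have fW: "f \<in> carrier W"
    proof -
      have "{b \<in> carrier B. fst f b \<noteq> \<one>\<^bsub>A\<^esub>} \<subseteq> ?BB" using g1 by (auto simp: f_def)
      then have "finite {b \<in> carrier B. fst f b \<noteq> \<one>\<^bsub>A\<^esub>}"
        using B.finite_ball[OF B.one_closed] by (rule finite_subset)
      then show ?thesis unfolding mem_W_iff using g2 by (auto simp: f_def ball_on_def)
    qed
    moreover have "u \<otimes>\<^bsub>W\<^esub> f = v"
    proof (rule W_eqI)
      fix b assume b: "b \<in> carrier B"
      have "snd u \<otimes>\<^bsub>B\<^esub> (inv\<^bsub>B\<^esub> (snd u) \<otimes>\<^bsub>B\<^esub> b) = b" using p b by (simp add: B.m_assoc[symmetric])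
      then show "fst (u \<otimes>\<^bsub>W\<^esub> f) b = fst v b"
        using p b W_lamp[OF u b] W_lamp[OF v b]
        by (simp add: W_mult_lamp f_def g_def A.m_assoc[symmetric])
    qed (use u v fW eq p in \<open>auto simp: W_mult_pos f_def\<close>)
    ultimately show ?thesis
      using W.wd_left_invariant[of u "\<one>\<^bsub>W\<^esub>" f] u fin by simp
  qed
  moreover have "0 \<le> Max (insert 0 (dW \<one>\<^bsub>W\<^esub> ` F))" using fin by simp
  ultimately show ?thesis by blast
qed

lemma coset_of_pos:
  assumes u: "u \<in> carrier W" and p: "p \<in> carrier B"
  shows "(fst u, p) \<in> (fst u, \<one>\<^bsub>B\<^esub>) <#\<^bsub>W\<^esub> acting_subgroup A B"
proof -
  let ?v = "(\<lambda>b\<in>carrier B. \<one>\<^bsub>A\<^esub>, p)"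
  have "?v \<in> acting_subgroup A B" using p by (simp add: acting_subgroup_def)
  moreover have "(fst u, \<one>\<^bsub>B\<^esub>) \<otimes>\<^bsub>W\<^esub> ?v = (fst u, p)"
  proof (rule W_eqI)
    have 1: "(fst u, \<one>\<^bsub>B\<^esub>) \<in> carrier W" "?v \<in> carrier W" using u p by (auto simp: mem_W_iff)
    then show "(fst u, \<one>\<^bsub>B\<^esub>) \<otimes>\<^bsub>W\<^esub> ?v \<in> carrier W" by (rule W.m_closed)
    show "(fst u, p) \<in> carrier W" using u p by (auto simp: mem_W_iff)
  qed (use p W_lamp[OF u] in \<open>auto simp: W_mult_lamp W_mult_pos\<close>)
  ultimately show ?thesis by (auto simp: l_coset_def intro!: bexI[of _ ?v])
qed

end

section \<open>Coarse maps into wreath products\<close>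

locale mapped_wreath = marked_wreath A B SA SB T + G: marked_group G S
  for A :: "('a, 'c) monoid_scheme" and B :: "('b, 'd) monoid_scheme" and SA SB T
    and G :: "('g, 'e) monoid_scheme" and S +
  fixes \<kappa> M :: real
  assumes kappa_pos: "\<kappa> > 0" and sub_A: "subexponential (\<lambda>r. real (A.growth r))"
begin

abbreviation "dG \<equiv> word_dist G S"

text \<open>What the argument uses of a coarse embedding, expressed through lamps and arrow: \<open>\<kappa>\<close> and \<open>M\<close> are
  determined by the parameters of the embedding and by the generating sets, so bounds in terms of
  them are uniform.\<close>

definition tame :: "('g \<Rightarrow> ('b \<Rightarrow> 'a) \<times> 'b) \<Rightarrow> bool" where
  "tame \<rho> \<longleftrightarrow> \<rho> \<in> carrier G \<rightarrow> carrier W \<and>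
     (\<forall>x\<in>carrier G. \<forall>y\<in>carrier G. dB (snd (\<rho> x)) (snd (\<rho> y)) \<le> \<kappa> * dG x y \<and>
        (\<forall>b\<in>carrier B. (fst (\<rho> x) b \<noteq> fst (\<rho> y) b \<longrightarrow> dB (snd (\<rho> x)) b \<le> \<kappa> * dG x y) \<and>
           dA (fst (\<rho> x) b) (fst (\<rho> y) b) \<le> \<kappa> * dG x y) \<and>
        (\<rho> x = \<rho> y \<longrightarrow> dG x y \<le> M))"

definition sites :: "('g \<Rightarrow> ('b \<Rightarrow> 'a) \<times> 'b) \<Rightarrow> 'b \<Rightarrow> real \<Rightarrow> 'g set" where
  "sites \<rho> p K = {x \<in> carrier G. dB p (snd (\<rho> x)) \<le> K}"

lemma tameD:
  assumes "tame \<rho>" "x \<in> carrier G"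
  shows tame_W: "\<rho> x \<in> carrier W"
    and tame_pos: "y \<in> carrier G \<Longrightarrow> dB (snd (\<rho> x)) (snd (\<rho> y)) \<le> \<kappa> * dG x y"
    and tame_supp: "y \<in> carrier G \<Longrightarrow> b \<in> carrier B \<Longrightarrow> fst (\<rho> x) b \<noteq> fst (\<rho> y) b \<Longrightarrow>
      dB (snd (\<rho> x)) b \<le> \<kappa> * dG x y"
    and tame_lamp: "y \<in> carrier G \<Longrightarrow> b \<in> carrier B \<Longrightarrow> dA (fst (\<rho> x) b) (fst (\<rho> y) b) \<le> \<kappa> * dG x y"
    and tame_fibre: "y \<in> carrier G \<Longrightarrow> \<rho> x = \<rho> y \<Longrightarrow> dG x y \<le> M"
  using assms unfolding tame_def by (auto simp only: Pi_iff)

lemma sites_subset: "sites \<rho> p K \<subseteq> carrier G"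
  by (auto simp: sites_def)

text \<open>During a hop of length at most \<open>h\<close> that starts with the arrow within \<open>K\<close> of \<open>p\<close>, no lamp beyond
  distance \<open>K + \<kappa> * h\<close> from \<open>p\<close> can change.\<close>

lemma component_lamps:
  assumes t: "tame \<rho>" and p: "p \<in> carrier B" and b: "b \<in> carrier B"
    and far: "K + \<kappa> * h < dB p b" and z: "z \<in> sites \<rho> p K"
  shows "x \<in> G.component_of h (sites \<rho> p K) z \<Longrightarrow> fst (\<rho> x) b = fst (\<rho> z) b"
  unfolding G.component_of_def Image_singleton mem_Collect_eq
proof (induction rule: rtrancl_induct)
  case (step x y)
  then have xy: "x \<in> carrier G" "y \<in> carrier G" "dB p (snd (\<rho> x)) \<le> K" "dG x y \<le> h"
    by (auto simp: G.hops_def sites_def)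
  have "fst (\<rho> x) b = fst (\<rho> y) b"
  proof (rule ccontr)
    assume "fst (\<rho> x) b \<noteq> fst (\<rho> y) b"
    then have "dB (snd (\<rho> x)) b \<le> \<kappa> * dG x y" using tame_supp t xy b by blast
    also have "\<dots> \<le> \<kappa> * h" using xy kappa_pos by simp
    finally have "dB (snd (\<rho> x)) b \<le> \<kappa> * h" .
    moreover have "dB p b \<le> dB p (snd (\<rho> x)) + dB (snd (\<rho> x)) b"
      using p b W_pos[OF tame_W[OF t xy(1)]] by (intro B.wd_triangle)
    ultimately show False using far xy by linarith
  qed
  with step.IH show ?case by simp
qed simp

text \<open>The factors count the points of a fibre of \<open>\<rho>\<close>, the positions of the arrow near \<open>p\<close>, and the states of
  the lamps near \<open>p\<close>.\<close>

definition vol :: "real \<Rightarrow> real \<Rightarrow> real \<Rightarrow> real" where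
  "vol K h r = real (G.growth M) * (real (B.growth K) * real (A.growth (\<kappa> * r)) ^ B.growth (K + \<kappa> * h))"

lemma subexponential_vol: "subexponential (vol K h)"
proof -
  have "subexponential (\<lambda>r. real (A.growth (\<kappa> * r)))"
    using subexponential_affine[OF sub_A kappa_pos, of 0] by simp
  then show ?thesis
    unfolding vol_def[abs_def]
    by (intro subexponential_mult subexponential_const subexponential_power) auto
qed

text \<open>All lamps outside the finite ball \<open>F\<close> about \<open>p\<close> are constant on the component.  Hence a point of it is
  determined, up to the fibre of \<open>\<rho>\<close>, by the position of its arrow and by its lamps in \<open>F\<close>, and over
  distance \<open>r\<close> each of these lamps moves by at most \<open>\<kappa> * r\<close> in \<open>A\<close>.  This is where the subexponential
  growth of \<open>A\<close> enters.\<close>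

lemma component_volume:
  assumes t: "tame \<rho>" and p: "p \<in> carrier B" and z: "z \<in> sites \<rho> p K"
    and x0: "x0 \<in> G.component_of h (sites \<rho> p K) z" and r: "0 \<le> r"
  shows "real (card (ball_on (carrier G) dG x0 r \<inter> G.component_of h (sites \<rho> p K) z)) \<le> vol K h r"
proof -
  let ?Z = "G.component_of h (sites \<rho> p K) z"
  define X where "X = ball_on (carrier G) dG x0 r \<inter> ?Z"
  define F where "F = ball_on (carrier B) dB p (K + \<kappa> * h)"
  define \<Phi> where "\<Phi> x = (restrict (fst (\<rho> x)) F, snd (\<rho> x))" for x
  define Y where "Y = (\<Pi>\<^sub>E b\<in>F. ball_on (carrier A) dA (fst (\<rho> x0) b) (\<kappa> * r)) \<times> ball_on (carrier B) dB p K"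
  have ZY: "?Z \<subseteq> sites \<rho> p K" using z by (rule G.component_of_subset)
  then have "?Z \<subseteq> carrier G" using sites_subset by (rule subset_trans)
  then have x0G: "x0 \<in> carrier G" and XG: "X \<subseteq> carrier G" using x0 by (auto simp: X_def ball_on_def)
  have FB: "F \<subseteq> carrier B" and finF: "finite F"
    using B.finite_ball[OF p] by (auto simp: F_def ball_on_def)
  have lampA: "fst (\<rho> x) b \<in> carrier A" if "x \<in> carrier G" "b \<in> carrier B" for x b
    using W_lamp[OF tame_W[OF t that(1)] that(2)] .
  have finY: "finite Y"
    unfolding Y_def using finF FB lampA[OF x0G] p
    by (intro finite_cartesian_product finite_PiE A.finite_ball B.finite_ball) auto
  have cardY: "card Y = A.growth (\<kappa> * r) ^ B.growth (K + \<kappa> * h) * B.growth K"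
  proof -
    have "(\<Prod>b\<in>F. card (ball_on (carrier A) dA (fst (\<rho> x0) b) (\<kappa> * r))) = (\<Prod>b\<in>F. A.growth (\<kappa> * r))"
      using FB lampA[OF x0G] by (intro prod.cong refl A.card_ball) auto
    moreover have "card F = B.growth (K + \<kappa> * h)" unfolding F_def by (rule B.card_ball[OF p])
    ultimately show ?thesis
      unfolding Y_def by (simp add: card_cartesian_product card_PiE[OF finF] B.card_ball[OF p])
  qed
  have \<Phi>Y: "\<Phi> x \<in> Y" if x: "x \<in> X" for x
  proof -
    have xG: "x \<in> carrier G" using x XG by blast
    have "dG x0 x \<le> r" using x by (simp add: X_def ball_on_def)
    then have "\<kappa> * dG x0 x \<le> \<kappa> * r" using kappa_pos by simp
    then have "dA (fst (\<rho> x0) b) (fst (\<rho> x) b) \<le> \<kappa> * r" if "b \<in> F" for b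
      using tame_lamp[OF t x0G xG, of b] that FB by force
    moreover have "snd (\<rho> x) \<in> ball_on (carrier B) dB p K"
      using x ZY W_pos[OF tame_W[OF t xG]] by (auto simp: X_def sites_def ball_on_def)
    ultimately show ?thesis using FB lampA[OF xG] by (auto simp: \<Phi>_def Y_def ball_on_def)
  qed
  have fibre: "card {x \<in> X. \<Phi> x = y} \<le> G.growth M" for y
  proof (cases "{x \<in> X. \<Phi> x = y} = {}")
    case False
    then obtain x1 where x1: "x1 \<in> X" "\<Phi> x1 = y" by blast
    have x1G: "x1 \<in> carrier G" using x1 XG by blast
    have "{x \<in> X. \<Phi> x = y} \<subseteq> ball_on (carrier G) dG x1 M"
    proof clarify
      fix x assume x: "x \<in> X" and y: "y = \<Phi> x"
      have xG: "x \<in> carrier G" using x XG by blast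
      have "\<rho> x1 = \<rho> x"
      proof (rule W_eqI)
        show "snd (\<rho> x1) = snd (\<rho> x)" using x1(2) y by (simp add: \<Phi>_def)
        fix b assume b: "b \<in> carrier B"
        show "fst (\<rho> x1) b = fst (\<rho> x) b"
        proof (cases "b \<in> F")
          case True
          have "restrict (fst (\<rho> x1)) F = restrict (fst (\<rho> x)) F" using x1(2) y by (simp add: \<Phi>_def)
          from fun_cong[OF this, of b] True show ?thesis by simp
        next
          case False
          then have "K + \<kappa> * h < dB p b" using b by (simp add: F_def ball_on_def)
          from component_lamps[OF t p b this z] x x1(1) show ?thesis by (simp add: X_def)
        qed
      qed (use tame_W[OF t] xG x1G in auto)
      then have "dG x1 x \<le> M" using tame_fibre[OF t x1G xG] by blast
      with xG show "x \<in> ball_on (carrier G) dG x1 M" by (simp add: ball_on_def)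
    qed
    from card_mono[OF G.finite_ball[OF x1G] this] show ?thesis by (simp add: G.card_ball[OF x1G])
  next
    case True then show ?thesis by (simp only: card.empty)
  qed
  have "X = (\<Union>y\<in>Y. {x \<in> X. \<Phi> x = y})" using \<Phi>Y by auto
  then have "card X \<le> (\<Sum>y\<in>Y. card {x \<in> X. \<Phi> x = y})" using card_UN_le[OF finY] by metis
  also have "\<dots> \<le> card Y * G.growth M" using sum_bounded_above[of Y _ "G.growth M"] fibre by simp
  finally have "card X \<le> card Y * G.growth M" .
  then have "real (card X) \<le> real (card Y * G.growth M)" by (rule of_nat_mono)
  then show ?thesis unfolding X_def[symmetric] cardY vol_def by (simp add: mult_ac)
qed

text \<open>If the arrow stayed within \<open>K\<close> of \<open>p\<close> on a whole ball, then that ball would lie in a single component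
  and have subexponential volume; for a suitable radius \<open>Q\<close> the growth of \<open>G\<close> exceeds that.\<close>

lemma escape:
  assumes "exponential_growth G"
  shows "\<exists>Q\<ge>0. \<forall>\<rho> p x. tame \<rho> \<longrightarrow> p \<in> carrier B \<longrightarrow> x \<in> carrier G \<longrightarrow>
    (\<exists>y\<in>carrier G. dG x y \<le> Q \<and> K < dB p (snd (\<rho> y)))"
proof -
  obtain Q where Q: "Q \<ge> 0" "vol K 1 Q < G.growth Q"
    using G.exponential_growth_exceeds[OF assms subexponential_vol] by blast
  have "\<exists>y\<in>carrier G. dG x y \<le> Q \<and> K < dB p (snd (\<rho> y))"
    if t: "tame \<rho>" and p: "p \<in> carrier B" and x: "x \<in> carrier G" for \<rho> p x
  proof (rule ccontr)
    assume neg: "\<not> ?thesis"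
    let ?Y = "sites \<rho> p K" and ?B = "ball_on (carrier G) dG x Q"
    have BY: "?B \<subseteq> ?Y" using neg by (auto simp: ball_on_def sites_def not_less)
    have xY: "x \<in> ?Y" using BY x Q by (auto simp: ball_on_def)
    have *: "x \<otimes>\<^bsub>G\<^esub> G.word_prod w \<in> G.component_of 1 ?Y x" if "set w \<subseteq> G.letters" "length w \<le> Q" for w
      using that
    proof (induction w rule: rev_induct)
      case Nil then show ?case using x by (simp add: G.component_of_def)
    next
      case (snoc s w)
      have s: "s \<in> G.letters" "s \<in> carrier G" and w: "set w \<subseteq> G.letters" "set w \<subseteq> carrier G"
        using snoc.prems G.letters_closed G.letters_carrier[of w] by auto
      have ws: "G.word_prod (w @ [s]) = G.word_prod w \<otimes>\<^bsub>G\<^esub> s"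
        using G.word_prod_append[of w "[s]"] s w by simp
      let ?u = "x \<otimes>\<^bsub>G\<^esub> G.word_prod w"
      have u: "?u \<in> carrier G" using x w by simp
      have uZ: "?u \<in> G.component_of 1 ?Y x" using snoc w by simp
      have "x \<otimes>\<^bsub>G\<^esub> G.word_prod (w @ [s]) \<in> ?B"
        using G.wd_le_length[OF x snoc.prems(1)] snoc.prems(2) x s w
        by (simp add: ball_on_def ws del: foldr_append)
      then have v: "?u \<otimes>\<^bsub>G\<^esub> s \<in> ?Y" using BY x s w unfolding ws by (auto simp: G.m_assoc)
      have "?u \<otimes>\<^bsub>G\<^esub> s \<in> G.component_of 1 ?Y x"
        using uZ G.component_of_subset[OF xY] v G.wd_letter[OF u s(1)]
        by (intro G.component_of_step[OF uZ]) auto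
      then show ?case unfolding ws using x s w by (simp add: G.m_assoc)
    qed
    have "?B \<subseteq> G.component_of 1 ?Y x"
    proof
      fix y assume y: "y \<in> ?B"
      then obtain w where w: "set w \<subseteq> G.letters" "x \<otimes>\<^bsub>G\<^esub> G.word_prod w = y" "real (length w) = dG x y"
        using G.geodesic[OF x, of y] by (auto simp: ball_on_def)
      from *[OF w(1)] w y show "y \<in> G.component_of 1 ?Y x" by (simp add: ball_on_def)
    qed
    then have "?B \<inter> G.component_of 1 ?Y x = ?B" by blast
    moreover have "x \<in> G.component_of 1 ?Y x" by (simp add: G.component_of_def)
    ultimately have "real (card ?B) \<le> vol K 1 Q"
      using component_volume[OF t p xY, of x 1 Q] Q(1) by simp
    with Q(2) show False by (simp add: G.card_ball[OF x])
  qed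
  with Q(1) show ?thesis by blast
qed

text \<open>The lamp at \<open>p\<close> changes only along edges with both ends in \<open>sites \<rho> p \<kappa>\<close>.  Points at which the arrow is
  far from \<open>p\<close> are far from this set, and no component of it separates them, since the components have
  uniformly subexponential growth.\<close>

lemma lamp_constant_far_away:
  assumes M: "group_in_M_exp G" and loops: "short_loops_suffice G S l"
  shows "\<exists>K\<ge>0. \<forall>\<rho> p x y. tame \<rho> \<longrightarrow> p \<in> carrier B \<longrightarrow> x \<in> carrier G \<longrightarrow> y \<in> carrier G \<longrightarrow>
    K < dB p (snd (\<rho> x)) \<longrightarrow> K < dB p (snd (\<rho> y)) \<longrightarrow> fst (\<rho> x) p = fst (\<rho> y) p"
proof -
  \<comment> \<open>at scale \<open>h\<close> a loop of length at most \<open>l\<close> meets at most one component, and so does a single edge\<close>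
  define h where "h = real l + 1"
  define \<Z> where "\<Z> = {G.component_of h (sites \<rho> p \<kappa>) z | \<rho> p z. tame \<rho> \<and> p \<in> carrier B \<and> z \<in> sites \<rho> p \<kappa>}"
  have "\<exists>D\<ge>0. \<forall>Z\<in>\<Z>. \<forall>x\<in>carrier G. \<forall>y\<in>carrier G.
    (\<forall>z\<in>Z. D \<le> dG x z) \<longrightarrow> (\<forall>z\<in>Z. D \<le> dG y z) \<longrightarrow> (x, y) \<in> (G.edges_avoiding Z)\<^sup>*"
  proof (rule G.far_points_connected[OF M subexponential_vol[of \<kappa> h]])
    fix Z assume "Z \<in> \<Z>"
    then show "Z \<subseteq> carrier G"
      unfolding \<Z>_def using G.component_of_subset sites_subset by blast
  next
    fix Z z and r :: real assume "Z \<in> \<Z>" "z \<in> Z" "0 \<le> r"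
    then show "real (card (ball_on (carrier G) dG z r \<inter> Z)) \<le> vol \<kappa> h r"
      unfolding \<Z>_def using component_volume by blast
  qed
  then obtain D where D0: "D \<ge> 0" and D: "\<And>Z x y. Z \<in> \<Z> \<Longrightarrow> x \<in> carrier G \<Longrightarrow> y \<in> carrier G \<Longrightarrow>
      (\<forall>z\<in>Z. D \<le> dG x z) \<Longrightarrow> (\<forall>z\<in>Z. D \<le> dG y z) \<Longrightarrow> (x, y) \<in> (G.edges_avoiding Z)\<^sup>*"
    by blast
  define K where "K = \<kappa> + \<kappa> * D"
  have "K \<ge> 0" using D0 kappa_pos by (simp add: K_def)
  moreover have "fst (\<rho> x) p = fst (\<rho> y) p"
    if t: "tame \<rho>" and p: "p \<in> carrier B" and x: "x \<in> carrier G" and y: "y \<in> carrier G"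
      and xfar: "K < dB p (snd (\<rho> x))" and yfar: "K < dB p (snd (\<rho> y))" for \<rho> p x y
  proof -
    let ?Y = "sites \<rho> p \<kappa>"
    \<comment> \<open>an integer-valued test for the state of the lamp: the values in \<open>A\<close> themselves need not commute, so
      their increments on different components could not be separated\<close>
    define f :: "'g \<Rightarrow> int" where "f u = (if fst (\<rho> u) p = fst (\<rho> x) p then 1 else 0)" for u
    have pos: "snd (\<rho> u) \<in> carrier B" if "u \<in> carrier G" for u using W_pos[OF tame_W[OF t that]] .
    have far: "D \<le> dG u z" if u: "u \<in> carrier G" "K < dB p (snd (\<rho> u))" and z: "z \<in> ?Y" for u z
    proof -
      have zG: "z \<in> carrier G" "dB p (snd (\<rho> z)) \<le> \<kappa>" using z by (auto simp: sites_def)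
      have "dB p (snd (\<rho> u)) \<le> dB p (snd (\<rho> z)) + dB (snd (\<rho> z)) (snd (\<rho> u))"
        by (intro B.wd_triangle p pos zG u)
      moreover have "dB (snd (\<rho> z)) (snd (\<rho> u)) \<le> \<kappa> * dG z u" by (rule tame_pos[OF t zG(1) u(1)])
      ultimately have "\<kappa> * D \<le> \<kappa> * dG z u" using zG(2) u(2) unfolding K_def by linarith
      then have "D \<le> dG z u" using kappa_pos by simp
      then show ?thesis using G.wd_sym[OF zG(1) u(1)] by simp
    qed
    have "f x = f y"
    proof (rule G.constant_unless_component_separates[OF loops sites_subset _ _ _ x y])
      fix u s assume u: "u \<in> carrier G" and s: "s \<in> G.letters" and ne: "f u \<noteq> f (u \<otimes>\<^bsub>G\<^esub> s)"
      have us: "u \<otimes>\<^bsub>G\<^esub> s \<in> carrier G" using u s G.letters_closed by blast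
      have le: "\<kappa> * dG u (u \<otimes>\<^bsub>G\<^esub> s) \<le> \<kappa>" using G.wd_letter[OF u s] kappa_pos by simp
      have ne': "fst (\<rho> u) p \<noteq> fst (\<rho> (u \<otimes>\<^bsub>G\<^esub> s)) p" using ne by (auto simp: f_def)
      have "dB (snd (\<rho> u)) p \<le> \<kappa>" using tame_supp[OF t u us p ne'] le by linarith
      moreover have "dB (snd (\<rho> (u \<otimes>\<^bsub>G\<^esub> s))) p \<le> \<kappa>"
        using tame_supp[OF t us u p ne'[symmetric]] le G.wd_sym[OF u us] by simp
      ultimately show "u \<in> ?Y \<and> u \<otimes>\<^bsub>G\<^esub> s \<in> ?Y"
        using u us B.wd_sym[OF p pos[OF u]] B.wd_sym[OF p pos[OF us]] by (simp add: sites_def)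
    next
      fix z assume z: "z \<in> ?Y"
      then have Z: "G.component_of h ?Y z \<in> \<Z>" using t p unfolding \<Z>_def by blast
      show "(y, x) \<in> (G.edges_avoiding (G.component_of h ?Y z))\<^sup>*"
        using far[OF x xfar] far[OF y yfar] G.component_of_subset[OF z]
        by (intro D[OF Z y x]) auto
    qed (simp_all add: h_def)
    then show ?thesis by (simp add: f_def split: if_splits)
  qed
  ultimately show ?thesis by blast
qed

text \<open>Let \<open>c b\<close> be the common state of the lamp at \<open>b\<close> at all points at which the arrow is far from \<open>b\<close>.  At
  every point \<open>x\<close> the configuration then agrees with \<open>c\<close> far from the arrow.  Near the arrow it is close
  to \<open>c\<close>, as the arrow can leave the neighbourhood of any given lamp within distance \<open>Q\<close>.  Hence \<open>\<rho> x\<close>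
  is uniformly close to the element with configuration \<open>c\<close> and the same arrow, and these elements lie
  in a single coset.\<close>

theorem tame_map_near_coset:
  assumes M: "group_in_M_exp G" and loops: "short_loops_suffice G S l" and exp: "exponential_growth G"
  shows "\<exists>R\<ge>0. \<forall>\<rho>. tame \<rho> \<longrightarrow>
    (\<exists>C \<in> acting_cosets A B. \<rho> ` carrier G \<subseteq> nbhd (carrier W) dW C R)"
proof -
  obtain K where K: "K \<ge> 0" and const: "\<And>\<rho> p x y. tame \<rho> \<Longrightarrow> p \<in> carrier B \<Longrightarrow> x \<in> carrier G \<Longrightarrow> y \<in> carrier G \<Longrightarrow>
    K < dB p (snd (\<rho> x)) \<Longrightarrow> K < dB p (snd (\<rho> y)) \<Longrightarrow> fst (\<rho> x) p = fst (\<rho> y) p"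
    using lamp_constant_far_away[OF M loops] by blast
  obtain Q where Q: "Q \<ge> 0" and esc: "\<And>\<rho> p x. tame \<rho> \<Longrightarrow> p \<in> carrier B \<Longrightarrow> x \<in> carrier G \<Longrightarrow>
    \<exists>y\<in>carrier G. dG x y \<le> Q \<and> K < dB p (snd (\<rho> y))"
    using escape[OF exp, of K] by blast
  obtain R where R: "R \<ge> 0" and near: "\<And>u v. u \<in> carrier W \<Longrightarrow> v \<in> carrier W \<Longrightarrow> snd u = snd v \<Longrightarrow>
     (\<forall>b\<in>carrier B. (fst u b \<noteq> fst v b \<longrightarrow> dB (snd u) b \<le> K) \<and> dA (fst u b) (fst v b) \<le> \<kappa> * Q) \<Longrightarrow>
     dW u v \<le> R"
    using wreath_distance_upper[of K "\<kappa> * Q"] by blast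
  have "\<exists>C \<in> acting_cosets A B. \<rho> ` carrier G \<subseteq> nbhd (carrier W) dW C R" if t: "tame \<rho>" for \<rho>
  proof -
    define far where "far b = (SOME y. y \<in> carrier G \<and> K < dB b (snd (\<rho> y)))" for b
    have far: "far b \<in> carrier G \<and> K < dB b (snd (\<rho> (far b)))" if "b \<in> carrier B" for b
    proof -
      have "\<exists>y. y \<in> carrier G \<and> K < dB b (snd (\<rho> y))" using esc[OF t that G.one_closed] by blast
      then show ?thesis unfolding far_def by (rule someI_ex)
    qed
    define c where "c = (\<lambda>b\<in>carrier B. fst (\<rho> (far b)) b)"
    have pos: "snd (\<rho> x) \<in> carrier B" if "x \<in> carrier G" for x using W_pos[OF tame_W[OF t that]] .
    have c_far: "fst (\<rho> x) b = c b" if "x \<in> carrier G" "b \<in> carrier B" "K < dB b (snd (\<rho> x))" for x b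
      unfolding c_def using const[OF t that(2,1) _ that(3)] far[OF that(2)] that(2) by auto
    have c_near: "dB (snd (\<rho> x)) b \<le> K" if "x \<in> carrier G" "b \<in> carrier B" "fst (\<rho> x) b \<noteq> c b" for x b
      using c_far[OF that(1,2)] that(3) B.wd_sym[OF that(2) pos[OF that(1)]] by force
    have c_small: "dA (fst (\<rho> x) b) (c b) \<le> \<kappa> * Q" if x: "x \<in> carrier G" and b: "b \<in> carrier B" for x b
    proof -
      obtain y where y: "y \<in> carrier G" "dG x y \<le> Q" "K < dB b (snd (\<rho> y))" using esc[OF t b x] by blast
      have "dA (fst (\<rho> x) b) (c b) \<le> \<kappa> * dG x y"
        using tame_lamp[OF t x y(1) b] c_far[OF y(1) b y(3)] by simp
      also have "\<dots> \<le> \<kappa> * Q" using y kappa_pos by simp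
      finally show ?thesis .
    qed
    have cW: "(c, q) \<in> carrier W" if q: "q \<in> carrier B" for q
    proof -
      let ?x = "\<one>\<^bsub>G\<^esub>"
      have "{b \<in> carrier B. c b \<noteq> \<one>\<^bsub>A\<^esub>} \<subseteq> {b \<in> carrier B. fst (\<rho> ?x) b \<noteq> \<one>\<^bsub>A\<^esub>} \<union>
          ball_on (carrier B) dB (snd (\<rho> ?x)) K"
        using c_near[OF G.one_closed] by (auto simp: ball_on_def)
      moreover have "finite ({b \<in> carrier B. fst (\<rho> ?x) b \<noteq> \<one>\<^bsub>A\<^esub>} \<union>
          ball_on (carrier B) dB (snd (\<rho> ?x)) K)"
        using tame_W[OF t G.one_closed] B.finite_ball[OF pos[OF G.one_closed]] by (simp add: mem_W_iff)
      ultimately have "finite {b \<in> carrier B. c b \<noteq> \<one>\<^bsub>A\<^esub>}" by (rule finite_subset)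
      moreover have "c \<in> (\<Pi>\<^sub>E b\<in>carrier B. carrier A)"
        unfolding c_def using far W_lamp[OF tame_W[OF t]] by auto
      ultimately show ?thesis using q by (simp add: mem_W_iff)
    qed
    let ?C = "(c, \<one>\<^bsub>B\<^esub>) <#\<^bsub>W\<^esub> acting_subgroup A B"
    have "?C \<in> acting_cosets A B" unfolding acting_cosets_def using cW[OF B.one_closed] by blast
    moreover have "\<rho> x \<in> nbhd (carrier W) dW ?C R" if x: "x \<in> carrier G" for x
    proof (rule nbhdI)
      show "\<rho> x \<in> carrier W" by (rule tame_W[OF t x])
      show "(c, snd (\<rho> x)) \<in> ?C" using coset_of_pos[OF cW[OF B.one_closed] pos[OF x]] by simp
      show "dW (\<rho> x) (c, snd (\<rho> x)) \<le> R"
        by (rule near[OF tame_W[OF t x] cW[OF pos[OF x]]]) (use c_near[OF x] c_small[OF x] in auto)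
    qed
    ultimately show ?thesis by blast
  qed
  with R show ?thesis by blast
qed

end

theorem corollary1p8:
  fixes A :: "('a, 'c) monoid_scheme" and B :: "('b, 'd) monoid_scheme"
    and G :: "('g, 'e) monoid_scheme"
    and S :: "'g set" and T :: "(('b \<Rightarrow> 'a) \<times> 'b) set"
    and \<rho>m \<rho>p :: "real \<Rightarrow> real"
  assumes "group A" and "finitely_generated A" and "subexponential_growth A"
    and "group B" and "finitely_generated B"
    and "group G" and "finitely_presented G" and "exponential_growth G" and "group_in_M_exp G"
    and "finite_generating_set G S"
    and "finite_generating_set (wreath_product A B) T"
    and "coarse_params \<rho>m \<rho>p"
  shows "\<exists>R\<ge>0. \<forall>\<rho>.
    coarse_embedding (carrier G) (word_dist G S)
      (carrier (wreath_product A B)) (word_dist (wreath_product A B) T) \<rho>m \<rho>p \<rho> \<longrightarrow>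
    (\<exists>C \<in> acting_cosets A B.
      \<rho> ` carrier G \<subseteq> nbhd (carrier (wreath_product A B)) (word_dist (wreath_product A B) T) C R)"
proof -
  obtain SA where SA: "finite_generating_set A SA" "growth_rate A SA = 0"
    using assms(3) unfolding subexponential_growth_def by blast
  obtain SB where SB: "finite_generating_set B SB"
    using assms(5) unfolding finitely_generated_def by blast
  obtain S0 l where S0: "finite_generating_set G S0" and loops: "short_loops_suffice G S0 l"
    using finitely_presented_short_loops[OF assms(6,7)] by blast
  interpret A: marked_group A SA by (intro marked_group.intro marked_group_axioms.intro assms SA)
  interpret B: marked_group B SB by (intro marked_group.intro marked_group_axioms.intro assms SB)
  have "group (wreath_product A B)" using assms(1,4) by (intro wreath.group_W wreath.intro)
  then
  interpret W: marked_group "wreath_product A B" T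
    by (intro marked_group.intro marked_group_axioms.intro assms)
  interpret marked_wreath A B SA SB T ..
  interpret G: marked_group G S0 by (intro marked_group.intro marked_group_axioms.intro assms S0)
  interpret G': marked_group G S by (intro marked_group.intro marked_group_axioms.intro assms)
  obtain c where c: "c > 0" "\<forall>x\<in>carrier G. \<forall>y\<in>carrier G. G'.wd x y \<le> c * G.wd x y"
    using word_dist_bilipschitz[OF G'.marked_group_axioms G.marked_group_axioms] by blast
  obtain c' where c': "c' > 0" "\<forall>x\<in>carrier G. \<forall>y\<in>carrier G. G.wd x y \<le> c' * G'.wd x y"
    using word_dist_bilipschitz[OF G.marked_group_axioms G'.marked_group_axioms] by blast
  obtain k where k: "k > 0" and lower: "\<forall>u\<in>carrier W. \<forall>v\<in>carrier W. dB (snd u) (snd v) \<le> k * dW u v \<and>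
     (\<forall>b\<in>carrier B. (fst u b \<noteq> fst v b \<longrightarrow> dB (snd u) b \<le> k * dW u v) \<and>
        dA (fst u b) (fst v b) \<le> k * dW u v)"
    using wreath_distance_lower by blast
  have params: "\<rho>p c \<ge> 0" "mono_on {0..} \<rho>p" "filterlim \<rho>m at_top at_top"
    using assms(12) c(1) by (auto simp: coarse_params_def)
  have "\<forall>\<^sub>F t in at_top. 1 \<le> \<rho>m t" using params(3) by (simp add: filterlim_at_top)
  then obtain t0 where t0: "\<And>t. t0 \<le> t \<Longrightarrow> 1 \<le> \<rho>m t" by (auto simp: eventually_at_top_linorder)
  \<comment> \<open>an edge for \<open>S0\<close> has length at most \<open>c\<close> for \<open>S\<close>, so \<open>\<rho>p c\<close> is a Lipschitz constant of \<open>\<rho>\<close>; it may be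
    0, and the summand 1 keeps \<open>\<kappa>\<close> positive\<close>
  define \<kappa> where "\<kappa> = k * \<rho>p c + 1"
  \<comment> \<open>\<open>\<rho>m\<close> is positive from \<open>t0\<close> on, so points with the same image are at distance at most \<open>max 0 t0\<close>
    for \<open>S\<close>\<close>
  define M where "M = c' * max 0 t0"
  interpret mapped_wreath A B SA SB T G S0 \<kappa> M
  proof
    show "\<kappa> > 0" using k params(1) by (simp add: \<kappa>_def add_nonneg_pos)
    show "subexponential (\<lambda>r. real (A.growth r))" by (rule A.growth_rate_zero[OF SA(2)])
  qed
  have "tame \<rho>" if "coarse_embedding (carrier G) (word_dist G S) (carrier W) dW \<rho>m \<rho>p \<rho>" for \<rho>
  proof -
    have \<rho>: "\<rho> x \<in> carrier W" if "x \<in> carrier G" for x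
      using \<open>coarse_embedding _ _ _ _ _ _ _\<close> that by (auto simp: coarse_embedding_def)
    have emb: "\<rho>m (G'.wd x y) \<le> dW (\<rho> x) (\<rho> y)" "dW (\<rho> x) (\<rho> y) \<le> \<rho>p (G'.wd x y)"
      if "x \<in> carrier G" "y \<in> carrier G" for x y
      using \<open>coarse_embedding _ _ _ _ _ _ _\<close> that by (auto simp: coarse_embedding_def)
    have lip: "dW (\<rho> x) (\<rho> y) \<le> \<rho>p c * G.wd x y" if "x \<in> carrier G" "y \<in> carrier G" for x y
    proof (rule G.lipschitz_from_edges[OF _ _ _ that])
      fix x s assume x: "x \<in> carrier G" and s: "s \<in> G.letters"
      have xs: "x \<otimes>\<^bsub>G\<^esub> s \<in> carrier G" using x s G.letters_closed by blast
      have "G'.wd x (x \<otimes>\<^bsub>G\<^esub> s) \<le> c * G.wd x (x \<otimes>\<^bsub>G\<^esub> s)" using c(2) x xs by blast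
      also have "\<dots> \<le> c" using G.wd_letter[OF x s] c(1) by simp
      finally have "\<rho>p (G'.wd x (x \<otimes>\<^bsub>G\<^esub> s)) \<le> \<rho>p c"
        using c(1) by (intro mono_onD[OF params(2)]) auto
      with emb(2)[OF x xs] show "dW (\<rho> x) (\<rho> (x \<otimes>\<^bsub>G\<^esub> s)) \<le> \<rho>p c" by linarith
    next
      show "dW (\<rho> x) (\<rho> z) \<le> dW (\<rho> x) (\<rho> y) + dW (\<rho> y) (\<rho> z)"
        if "x \<in> carrier G" "y \<in> carrier G" "z \<in> carrier G" for x y z
        using that by (intro W.wd_triangle \<rho>)
      show "dW (\<rho> x) (\<rho> x) \<le> 0" if "x \<in> carrier G" for x using \<rho>[OF that] by simp
    qed
    have scale: "k * dW (\<rho> x) (\<rho> y) \<le> \<kappa> * dG x y" if "x \<in> carrier G" "y \<in> carrier G" for x y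
    proof -
      have "k * dW (\<rho> x) (\<rho> y) \<le> k * (\<rho>p c * dG x y)" using lip[OF that] k by simp
      also have "\<dots> \<le> \<kappa> * dG x y" by (simp add: \<kappa>_def algebra_simps)
      finally show ?thesis .
    qed
    have fibre: "dG x y \<le> M" if xy: "x \<in> carrier G" "y \<in> carrier G" and eq: "\<rho> x = \<rho> y" for x y
    proof -
      have "\<rho>m (G'.wd x y) \<le> 0" using emb(1)[OF xy] eq \<rho>[OF xy(2)] by simp
      then have "G'.wd x y \<le> max 0 t0" using t0[of "G'.wd x y"] by linarith
      then have "c' * G'.wd x y \<le> M" using c'(1) by (simp add: M_def)
      moreover have "dG x y \<le> c' * G'.wd x y" using c'(2) xy by blast
      ultimately show ?thesis by linarith
    qed
    show "tame \<rho>"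
      unfolding tame_def
    proof (intro conjI ballI impI Pi_I \<rho> fibre)
      fix x y assume xy: "x \<in> carrier G" "y \<in> carrier G"
      note low = lower[rule_format, OF \<rho>[OF xy(1)] \<rho>[OF xy(2)]]
      show "dB (snd (\<rho> x)) (snd (\<rho> y)) \<le> \<kappa> * dG x y" using low scale[OF xy] by linarith
      fix b assume b: "b \<in> carrier B"
      show "dA (fst (\<rho> x) b) (fst (\<rho> y) b) \<le> \<kappa> * dG x y"
        using conjunct2[OF low] b scale[OF xy] by force
      assume "fst (\<rho> x) b \<noteq> fst (\<rho> y) b"
      then show "dB (snd (\<rho> x)) b \<le> \<kappa> * dG x y"
        using conjunct2[OF low] b scale[OF xy] by force
    qed
  qed
  moreover obtain R where "R \<ge> 0" "\<forall>\<rho>. tame \<rho> \<longrightarrow>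
      (\<exists>C \<in> acting_cosets A B. \<rho> ` carrier G \<subseteq> nbhd (carrier W) dW C R)"
    using tame_map_near_coset[OF assms(9) loops assms(8)] by blast
  ultimately show ?thesis by blast
qed

end
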